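(* Let $\mathcal S$ be any topological space, let $\mathfrak B$ be any Boolean subalgebra of $\mathfrak R(\mathcal S)$, and let $\mathcal M(\mathfrak B)$ be the set of all contents on $\mathfrak B$. There exists a unique integrator $\fint$ on $\mathfrak B\times\mathcal L_{\mathfrak B}(\mathcal S)\times\mathcal M(\mathfrak B)$. For any bounded $f\in\mathcal F_{\mathfrak B}(\mathcal S)$, if $f$ is subordinate to the $\mathfrak B$-partition $\{P_1,\dots,P_N\}$ of $\mathcal S$, with $r_1,\dots,r_N\in\mathbb R$ such that $f(p)=r_n$ for all $p\in P_n$ and all $n\in\{1,\dots,N\}$, then for any $\mu\in\mathcal M(\mathfrak B)$ and $B\in\mathfrak B$, $$\fint_B f\,d\mu=\sum_{n=1}^N r_n\,\mu[P_n\cap B].$$ Meanwhile, for any $B\in\mathfrak B$, any $g\in\mathcal L_{\mathfrak B}(B)$ and any $\mu\in\mathcal M(\mathfrak B)$, $$\fint_B g\,d\mu=\sup_{f\in\mathcal F_g(B)}\ \fint_B f\,d\mu,$$ where $\mathcal F_g(B)$ is the set of bounded $f\in\mathcal F_{\mathfrak B}(B)$ such that $f(b)\le g(b)$ for all $b\in B$.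
   Context: An open set $R\subseteq\mathcal S$ is regular if $R=\mathrm{int}(\mathrm{clos}(R))$. $\mathfrak R(\mathcal S)$ is the set of regular open subsets of $\mathcal S$; it is a Boolean algebra with meet $\cap$, join $Q\vee R:=\mathrm{int}(\mathrm{clos}(Q\cup R))$ and complement $\neg R:=\mathrm{int}(\mathcal S\setminus R)$. A Boolean subalgebra $\mathfrak B\subseteq\mathfrak R(\mathcal S)$ is a subset closed under $\cap,\vee,\neg$. A content on $\mathfrak B$ is a function $\mu:\mathfrak B\to[0,\infty)$ such that $\mu[B_1\vee\cdots\vee B_N]=\sum_{n}\mu[B_n]$ for every finite collection of disjoint elements of $\mathfrak B$; by standing assumption $\mu[\mathcal S]=1$ for all contents considered in $\mathcal M(\mathfrak B)$ (the normalization is not imposed on the finitely additive set functions occurring in (I2) below). For $R\in\mathfrak B$, a $\mathfrak B$-partition of $R$ is a finite collection $\{B_1,\dots,B_N\}$ of disjoint elements of $\mathfrak B$ with $R=B_1\vee\cdots\vee B_N$. A function $f:\mathcal S\to\mathbb R$ is $\mathfrak B$-simple if there is a $\mathfrak B$-partition of $\mathcal S$ such that $f$ is constant on each cell (its values outside the union of the cells are arbitrary); $f$ is then said to be subordinate to that partition. $\mathcal F_{\mathfrak B}(\mathcal S)$ is the set of $\mathfrak B$-simple functions. A bounded function $h:\mathcal S\to\mathbb R$ is $\mathfrak B$-integrable if there are $\mathfrak B$-simple functions $f_n$ with $\|h-f_n\|_\infty\to0$; $\mathcal L_{\mathfrak B}(\mathcal S)$ is the set (a vector space) of $\mathfrak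 B$-integrable functions. For $B\in\mathfrak B$, $\mathcal F_{\mathfrak B}(B)$ and $\mathcal L_{\mathfrak B}(B)$ denote the sets of restrictions to $B$ of elements of $\mathcal F_{\mathfrak B}(\mathcal S)$ and $\mathcal L_{\mathfrak B}(\mathcal S)$, respectively. Let $\mathcal M$ be a set of contents on $\mathfrak B$ and $\mathcal H$ a vector space of bounded real-valued functions on $\mathcal S$ containing the constant function $\mathbf 1$. An integrator is a function $\fint:\mathfrak B\times\mathcal H\times\mathcal M\to\mathbb R$, written $\fint_B h\,d\mu:=\fint(B,h,\mu)$, such that: (I1) for all $B\in\mathfrak B$ and $\mu\in\mathcal M$, the map $h\mapsto\fint_B h\,d\mu$ is a linear functional on $\mathcal H$, bounded for the uniform norm, and nondecreasing (if $f\le g$ everywhere on $\mathcal S$ then $\fint_B f\,d\mu\le\fint_B g\,d\mu$); moreover $\fint_B\mathbf 1\,d\mu=\mu[B]$, and $\fint_B h\,d\mu=0$ whenever $h|_B=0$; (I2) for every non-negative $h\in\mathcal H$ and $\mu\in\mathcal M$, the map $B\mapsto\fint_B h\,d\mu$ is a (not necessarily normalized) content on $\mathfrak B$, i.e. $\fint_B h\,d\mu=\sum_{n=1}^N\fint_{B_n}h\,d\mu$ for any $\mathfrak B$-partition $\{B_n\}_{n=1}^N$ of $B$; (I3) for all $B\in\mathfrak B$ and $h\in\mathcal H$, the map $\mu\mapsto\fint_B h\,d\mu$ is linear on $\mathcal M$: if $\mu_1,\mu_2\in\mathcal M$, $r_1,r_2\in\mathbb R$ and $r_1\mu_1+r_2\mu_2\in\mathcal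 M$, then $\fint_B h\,d(r_1\mu_1+r_2\mu_2)=r_1\fint_B h\,d\mu_1+r_2\fint_B h\,d\mu_2$. By (I1), $\fint_B h\,d\mu$ depends only on $h|_B$, so for $g\in\mathcal L_{\mathfrak B}(B)$ one writes $\fint_B g\,d\mu$ for $\fint_B h\,d\mu$, where $h\in\mathcal L_{\mathfrak B}(\mathcal S)$ is any function with $h|_B=g$. *)

theory Defs
  imports "HOL-Analysis.Analysis"
begin

text \<open>
  The space is an abstract topology \<open>X\<close> with carrier \<open>topspace X\<close> (possibly empty).
  Functions on a set \<open>A\<close> are represented by \<open>extensional\<close> functions on \<open>A\<close>, so that
  equality in HOL is equality of functions on \<open>A\<close>, and \<open>restrict\<close> is the restriction map.
\<close>

definition regular_opens :: "'a topology \<Rightarrow> 'a set set" where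
  "regular_opens X = {R. openin X R \<and> R = X interior_of (X closure_of R)}"

definition rjoin :: "'a topology \<Rightarrow> 'a set \<Rightarrow> 'a set \<Rightarrow> 'a set" where
  "rjoin X Q R = X interior_of (X closure_of (Q \<union> R))"

definition rcompl :: "'a topology \<Rightarrow> 'a set \<Rightarrow> 'a set" where
  "rcompl X R = X interior_of (topspace X - R)"

text \<open>\<open>rjoin_upto X P N\<close> is \<open>P 1 \<or> \<dots> \<or> P N\<close>, the empty join being the zero element.\<close>

primrec rjoin_upto :: "'a topology \<Rightarrow> (nat \<Rightarrow> 'a set) \<Rightarrow> nat \<Rightarrow> 'a set" where
  "rjoin_upto X P 0 = {}"
| "rjoin_upto X P (Suc n) = rjoin X (rjoin_upto X P n) (P (Suc n))"

text \<open>Nonemptiness is part of being a subalgebra; it puts \<open>{}\<close> and \<open>topspace X\<close> in \<open>\<BB>\<close>.\<close>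

definition boolean_subalgebra :: "'a topology \<Rightarrow> 'a set set \<Rightarrow> bool" where
  "boolean_subalgebra X \<BB> \<longleftrightarrow>
     \<BB> \<subseteq> regular_opens X \<and> \<BB> \<noteq> {} \<and>
     (\<forall>Q\<in>\<BB>. \<forall>R\<in>\<BB>. Q \<inter> R \<in> \<BB> \<and> rjoin X Q R \<in> \<BB>) \<and>
     (\<forall>R\<in>\<BB>. rcompl X R \<in> \<BB>)"

definition algebra_partition ::
  "'a topology \<Rightarrow> 'a set set \<Rightarrow> 'a set \<Rightarrow> nat \<Rightarrow> (nat \<Rightarrow> 'a set) \<Rightarrow> bool" where
  "algebra_partition X \<BB> R N P \<longleftrightarrow>
     (\<forall>n\<in>{1..N}. P n \<in> \<BB>) \<and> disjoint_family_on P {1..N} \<and> R = rjoin_upto X P N"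

text \<open>Not necessarily normalized.\<close>

definition is_content :: "'a topology \<Rightarrow> 'a set set \<Rightarrow> ('a set \<Rightarrow> real) \<Rightarrow> bool" where
  "is_content X \<BB> \<mu> \<longleftrightarrow>
     \<mu> \<in> \<BB> \<rightarrow>\<^sub>E {0..} \<and>
     (\<forall>R N P. R \<in> \<BB> \<and> algebra_partition X \<BB> R N P \<longrightarrow> \<mu> R = (\<Sum>n=1..N. \<mu> (P n)))"

definition contents :: "'a topology \<Rightarrow> 'a set set \<Rightarrow> ('a set \<Rightarrow> real) set" where
  "contents X \<BB> = {\<mu>. is_content X \<BB> \<mu> \<and> \<mu> (topspace X) = 1}"

text \<open>Values outside the union of the cells are arbitrary, so simple functions may be unbounded.\<close>

definition simple_functions :: "'a topology \<Rightarrow> 'a set set \<Rightarrow> ('a \<Rightarrow> real) set" where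
  "simple_functions X \<BB> =
     {f \<in> extensional (topspace X).
        \<exists>N P. algebra_partition X \<BB> (topspace X) N P \<and> (\<forall>n\<in>{1..N}. f constant_on P n)}"

text \<open>Convergence in the uniform norm is stated with \<open>uniform_limit\<close>, which is meaningful
  for unbounded \<open>f n\<close> as well.\<close>

definition integrable_functions :: "'a topology \<Rightarrow> 'a set set \<Rightarrow> ('a \<Rightarrow> real) set" where
  "integrable_functions X \<BB> =
     {h \<in> extensional (topspace X). bounded (h ` topspace X) \<and>
        (\<exists>f. (\<forall>n. f n \<in> simple_functions X \<BB>) \<and>
             uniform_limit (topspace X) f h sequentially)}"

definition simple_functions_on :: "'a topology \<Rightarrow> 'a set set \<Rightarrow> 'a set \<Rightarrow> ('a \<Rightarrow> real) set" where
  "simple_functions_on X \<BB> B = (\<lambda>f. restrict f B) ` simple_functions X \<BB>"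

definition integrable_functions_on :: "'a topology \<Rightarrow> 'a set set \<Rightarrow> 'a set \<Rightarrow> ('a \<Rightarrow> real) set" where
  "integrable_functions_on X \<BB> B = (\<lambda>h. restrict h B) ` integrable_functions X \<BB>"

definition bounded_function_space :: "'a topology \<Rightarrow> ('a \<Rightarrow> real) set \<Rightarrow> bool" where
  "bounded_function_space X \<H> \<longleftrightarrow>
     \<H> \<subseteq> {h \<in> extensional (topspace X). bounded (h ` topspace X)} \<and>
     (\<lambda>x\<in>topspace X. 1) \<in> \<H> \<and>
     (\<forall>f\<in>\<H>. \<forall>g\<in>\<H>. \<forall>a b. (\<lambda>x\<in>topspace X. a * f x + b * g x) \<in> \<H>)"

text \<open>
  An integrator is a function on the product \<open>\<BB> \<times> \<H> \<times> \<M>\<close>; the extensionality condition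
  makes uniqueness literal. The \<open>SUP\<close> is the uniform norm: elements of \<open>\<H>\<close> are bounded,
  and \<open>topspace X\<close> is nonempty as soon as \<open>\<M>\<close> is, since contents are normalized.
\<close>

definition integrator ::
  "'a topology \<Rightarrow> 'a set set \<Rightarrow> ('a \<Rightarrow> real) set \<Rightarrow> ('a set \<Rightarrow> real) set \<Rightarrow>
     ('a set \<times> ('a \<Rightarrow> real) \<times> ('a set \<Rightarrow> real) \<Rightarrow> real) \<Rightarrow> bool" where
  "integrator X \<BB> \<H> \<M> I \<longleftrightarrow>
     bounded_function_space X \<H> \<and> \<M> \<subseteq> contents X \<BB> \<and> I \<in> extensional (\<BB> \<times> \<H> \<times> \<M>) \<and>
     (\<forall>B\<in>\<BB>. \<forall>\<mu>\<in>\<M>.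
        (\<forall>f\<in>\<H>. \<forall>g\<in>\<H>. \<forall>a b.
           I (B, (\<lambda>x\<in>topspace X. a * f x + b * g x), \<mu>) = a * I (B, f, \<mu>) + b * I (B, g, \<mu>)) \<and>
        (\<exists>C. \<forall>h\<in>\<H>. \<bar>I (B, h, \<mu>)\<bar> \<le> C * (SUP x\<in>topspace X. \<bar>h x\<bar>)) \<and>
        (\<forall>f\<in>\<H>. \<forall>g\<in>\<H>. (\<forall>x\<in>topspace X. f x \<le> g x) \<longrightarrow> I (B, f, \<mu>) \<le> I (B, g, \<mu>)) \<and>
        I (B, (\<lambda>x\<in>topspace X. 1), \<mu>) = \<mu> B \<and>
        (\<forall>h\<in>\<H>. (\<forall>b\<in>B. h b = 0) \<longrightarrow> I (B, h, \<mu>) = 0)) \<and>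
     (\<forall>h\<in>\<H>. \<forall>\<mu>\<in>\<M>. (\<forall>x\<in>topspace X. 0 \<le> h x) \<longrightarrow> is_content X \<BB> (\<lambda>B\<in>\<BB>. I (B, h, \<mu>))) \<and>
     (\<forall>B\<in>\<BB>. \<forall>h\<in>\<H>. \<forall>\<mu>\<^sub>1\<in>\<M>. \<forall>\<mu>\<^sub>2\<in>\<M>. \<forall>r\<^sub>1 r\<^sub>2.
        (\<lambda>A\<in>\<BB>. r\<^sub>1 * \<mu>\<^sub>1 A + r\<^sub>2 * \<mu>\<^sub>2 A) \<in> \<M> \<longrightarrow>
        I (B, h, (\<lambda>A\<in>\<BB>. r\<^sub>1 * \<mu>\<^sub>1 A + r\<^sub>2 * \<mu>\<^sub>2 A)) = r\<^sub>1 * I (B, h, \<mu>\<^sub>1) + r\<^sub>2 * I (B, h, \<mu>\<^sub>2))"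

text \<open>The integral over \<open>B\<close> of \<open>g \<in> integrable_functions_on X \<BB> B\<close>: the common value of
  \<open>I (B, h, \<mu>)\<close> over all integrable \<open>h\<close> extending \<open>g\<close>.\<close>

definition integral_restr ::
  "'a topology \<Rightarrow> 'a set set \<Rightarrow>
     ('a set \<times> ('a \<Rightarrow> real) \<times> ('a set \<Rightarrow> real) \<Rightarrow> real) \<Rightarrow>
     'a set \<Rightarrow> ('a \<Rightarrow> real) \<Rightarrow> ('a set \<Rightarrow> real) \<Rightarrow> real" where
  "integral_restr X \<BB> I B g \<mu> =
     (THE v. \<exists>h\<in>integrable_functions X \<BB>. restrict h B = g \<and> v = I (B, h, \<mu>))"

definition simple_minorants ::
  "'a topology \<Rightarrow> 'a set set \<Rightarrow> 'a set \<Rightarrow> ('a \<Rightarrow> real) \<Rightarrow> ('a \<Rightarrow> real) set" where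
  "simple_minorants X \<BB> B g =
     {f \<in> simple_functions_on X \<BB> B. bounded (f ` B) \<and> (\<forall>b\<in>B. f b \<le> g b)}"

end

theory Submission
  imports Defs
begin

text \<open>
  A step is a partition of the space with one real number attached to each cell; its
  integral over \<open>B\<close> is the finite sum in the theorem. Two steps live on a common refinement, and
  their integrals over \<open>B\<close> are then compared term by term, cells that miss \<open>B\<close> having content
  zero. So steps that approximate a function up to \<open>e\<close> on the cells within \<open>B\<close> have
  integrals determined up to a multiple of \<open>e\<close>, and the supremum of the integrals of the steps
  below a function is the only possible integral. What happens outside the
  union of the cells plays no role.
\<close>

text \<open>The topology enters through one operation, \<open>X interior_of (X closure_of _)\<close>
  on open sets: it commutes with finite intersections, which makes the algebra distributive,
  although the cells of a partition cover only a dense open part of the set that they partition. The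
  supremum ranges over step data and not over simple functions, so it is not tied to a choice of
  partition for a given function, and the arbitrary values off the cells never enter. It is
  evaluated once, in \<open>lower_integral_approx\<close>; afterwards every property of the integral
  is a statement about finite sums with an error \<open>e * \<mu> B\<close>. Two obstacles shape the
  second half. Additivity in the set is postulated for non-negative functions only, so signed
  functions are shifted by a constant first. And the supremum in the theorem is taken over functions
  that lie below \<open>g\<close> at all points of \<open>B\<close>, also between the cells; it is
  therefore not the supremum over steps and needs an argument of its own.\<close>

section \<open>Regularization of open sets\<close>

text \<open>Two approximations in a row: near a point of the right side lies a point
  \<open>y\<close> of \<open>U\<close> that is still inside the right side, hence in the closure of
  \<open>V\<close>, and the open set \<open>T \<inter> U\<close> around \<open>y\<close> then meets
  \<open>V\<close>. For two disjoint dense sets in a nonempty space the equation fails.\<close>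

lemma interior_closure_Int_open:
  assumes "openin X U" "openin X V"
  shows "X interior_of (X closure_of (U \<inter> V)) =
    X interior_of (X closure_of U) \<inter> X interior_of (X closure_of V)" (is "?L = ?R")
proof
  show "?L \<subseteq> ?R"
    by (simp add: closure_of_mono interior_of_mono)
  have "?R \<subseteq> X closure_of (U \<inter> V)"
  proof
    fix x assume x: "x \<in> ?R"
    then have xt: "x \<in> topspace X"
      using interior_of_subset_topspace by fastforce
    have "\<exists>y. y \<in> U \<inter> V \<and> y \<in> T" if T: "x \<in> T" "openin X T" for T
    proof -
      have "openin X (T \<inter> ?R)" "x \<in> T \<inter> ?R" "x \<in> X closure_of U"
        using T x interior_of_subset[of X "X closure_of U"] by (auto intro!: openin_Int)
      then obtain y where y: "y \<in> U" "y \<in> T \<inter> ?R"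
        by (meson in_closure_of)
      have "openin X (T \<inter> U)" "y \<in> T \<inter> U" "y \<in> X closure_of V"
        using T y assms interior_of_subset[of X "X closure_of V"] by (auto intro!: openin_Int)
      then obtain z where "z \<in> V" "z \<in> T \<inter> U"
        by (meson in_closure_of)
      then show ?thesis
        by blast
    qed
    then show "x \<in> X closure_of (U \<inter> V)"
      using xt by (auto simp: in_closure_of)
  qed
  then show "?R \<subseteq> ?L"
    by (simp add: interior_of_maximal openin_Int)
qed

text \<open>Regularizing an open set does not change its closure, and closure commutes with finite
  unions. This removes the inner regularizations from an iterated join.\<close>

lemma interior_closure_Un_open:
  assumes "openin X U" "V \<subseteq> topspace X"
  shows "X interior_of (X closure_of (X interior_of (X closure_of U) \<union> V)) =
    X interior_of (X closure_of (U \<union> V))"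
proof -
  have "X closure_of (X interior_of (X closure_of U)) = X closure_of U"
  proof
    show "X closure_of (X interior_of (X closure_of U)) \<subseteq> X closure_of U"
      by (metis closure_of_closure_of closure_of_mono interior_of_subset)
    have "U \<subseteq> X interior_of (X closure_of U)"
      using assms by (simp add: closure_of_subset interior_of_maximal openin_subset)
    then show "X closure_of U \<subseteq> X closure_of (X interior_of (X closure_of U))"
      by (rule closure_of_mono)
  qed
  then show ?thesis
    by simp
qed

lemma rjoin_upto_eq:
  assumes "\<forall>n\<in>{1..N}. openin X (P n)"
  shows "rjoin_upto X P N = X interior_of (X closure_of (\<Union>n\<in>{1..N}. P n))"
  using assms
proof (induction N)
  case (Suc N)
  have "rjoin_upto X P (Suc N) =
      X interior_of (X closure_of (X interior_of (X closure_of (\<Union>n\<in>{1..N}. P n)) \<union> P (Suc N)))"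
    using Suc by (simp add: rjoin_def)
  also have "\<dots> = X interior_of (X closure_of ((\<Union>n\<in>{1..N}. P n) \<union> P (Suc N)))"
    using Suc.prems by (intro interior_closure_Un_open openin_Union openin_subset) auto
  also have "(\<Union>n\<in>{1..N}. P n) \<union> P (Suc N) = (\<Union>n\<in>{1..Suc N}. P n)"
    by (auto simp: atLeastAtMostSuc_conv)
  finally show ?case .
qed simp

section \<open>Estimates for real numbers\<close>

text \<open>Identities between integrals are proved in this form, with \<open>C\<close> built from
  contents of fixed sets. Dividing by \<open>\<bar>C\<bar> + 1\<close> avoids a case distinction on
  the sign or vanishing of \<open>C\<close>.\<close>

lemma abs_diff_le_all_eq:
  fixes x y C :: real
  assumes "\<And>e. 0 < e \<Longrightarrow> \<bar>x - y\<bar> \<le> e * C"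
  shows "x = y"
proof -
  have "\<bar>x - y\<bar> \<le> 0 + d" if "d > 0" for d
  proof -
    have "\<bar>x - y\<bar> \<le> d / (\<bar>C\<bar> + 1) * C"
      using that by (intro assms) auto
    also have "\<dots> \<le> d / (\<bar>C\<bar> + 1) * (\<bar>C\<bar> + 1)"
      using that by (intro mult_left_mono) auto
    also have "\<dots> = d"
      by auto
    finally show ?thesis
      by simp
  qed
  then have "\<bar>x - y\<bar> \<le> 0"
    by (rule field_le_epsilon)
  then show ?thesis
    by simp
qed

lemma abs_linear_diff_le:
  fixes a b :: real
  assumes "\<bar>u - u'\<bar> \<le> d" "\<bar>v - v'\<bar> \<le> d"
  shows "\<bar>a * u + b * v - (a * u' + b * v')\<bar> \<le> (\<bar>a\<bar> + \<bar>b\<bar>) * d"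
proof -
  have "a * u + b * v - (a * u' + b * v') = a * (u - u') + b * (v - v')"
    by (simp add: algebra_simps)
  also have "\<bar>\<dots>\<bar> \<le> \<bar>a\<bar> * \<bar>u - u'\<bar> + \<bar>b\<bar> * \<bar>v - v'\<bar>"
    unfolding abs_mult[symmetric] by (rule abs_triangle_ineq)
  also have "\<dots> \<le> \<bar>a\<bar> * d + \<bar>b\<bar> * d"
    using assms by (intro add_mono mult_left_mono) auto
  finally show ?thesis
    by (simp add: distrib_right)
qed

text \<open>The values \<open>r\<close> are data of their own and not values of a function, so an
  empty cell may carry any number.\<close>

definition step_integral ::
  "nat \<Rightarrow> (nat \<Rightarrow> 'a set) \<Rightarrow> (nat \<Rightarrow> real) \<Rightarrow> ('a set \<Rightarrow> real) \<Rightarrow> 'a set \<Rightarrow> real" where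
  "step_integral N P r \<mu> B = (\<Sum>n=1..N. r n * \<mu> (P n \<inter> B))"

lemma step_integral_linear:
  "step_integral N P (\<lambda>n. a * r n + b * s n) \<mu> B =
    a * step_integral N P r \<mu> B + b * step_integral N P s \<mu> B"
  by (simp add: step_integral_def distrib_right sum.distrib sum_distrib_left mult.assoc)

section \<open>The algebra and its partitions\<close>

locale regular_open_algebra =
  fixes X :: "'a topology" and \<BB> :: "'a set set"
  assumes subalgebra: "boolean_subalgebra X \<BB>"
begin

lemma regular: "B \<in> \<BB> \<Longrightarrow> X interior_of (X closure_of B) = B"
  using subalgebra by (auto simp: boolean_subalgebra_def regular_opens_def)

lemma open_mem: "B \<in> \<BB> \<Longrightarrow> openin X B"
  using subalgebra by (auto simp: boolean_subalgebra_def regular_opens_def)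

lemma Int_mem: "A \<in> \<BB> \<Longrightarrow> B \<in> \<BB> \<Longrightarrow> A \<inter> B \<in> \<BB>"
  using subalgebra by (auto simp: boolean_subalgebra_def)

lemma empty_mem: "{} \<in> \<BB>"
proof -
  obtain B where B: "B \<in> \<BB>" "rcompl X B \<in> \<BB>"
    using subalgebra by (auto simp: boolean_subalgebra_def)
  have "B \<inter> rcompl X B = {}"
    unfolding rcompl_def using interior_of_subset by fastforce
  then show ?thesis
    using Int_mem[OF B] by simp
qed

lemma topspace_mem: "topspace X \<in> \<BB>"
proof -
  have "rcompl X {} \<in> \<BB>"
    using subalgebra empty_mem by (auto simp: boolean_subalgebra_def)
  then show ?thesis
    by (simp add: rcompl_def)
qed

lemma partition_iff:
  "algebra_partition X \<BB> R N P \<longleftrightarrow> (\<forall>n\<in>{1..N}. P n \<in> \<BB>) \<and> disjoint_family_on P {1..N} \<and>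
    R = X interior_of (X closure_of (\<Union>n\<in>{1..N}. P n))"
  unfolding algebra_partition_def using rjoin_upto_eq open_mem by metis

lemma partition_mem: "algebra_partition X \<BB> R N P \<Longrightarrow> n \<in> {1..N} \<Longrightarrow> P n \<in> \<BB>"
  by (simp add: algebra_partition_def)

text \<open>This is distributivity of meet over join: \<open>B\<close> is its own regularization, so
  regularizing the intersection of \<open>B\<close> with the union of the cells gives
  \<open>R \<inter> B\<close>, which is \<open>B\<close>.\<close>

lemma partition_Int:
  assumes "algebra_partition X \<BB> R N P" "B \<in> \<BB>" "B \<subseteq> R"
  shows "algebra_partition X \<BB> B N (\<lambda>n. P n \<inter> B)"
proof -
  have P: "\<forall>n\<in>{1..N}. P n \<in> \<BB>" "disjoint_family_on P {1..N}"
      "R = X interior_of (X closure_of (\<Union>n\<in>{1..N}. P n))"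
    using assms(1) by (auto simp: partition_iff)
  have eq: "(\<Union>n\<in>{1..N}. P n \<inter> B) = (\<Union>n\<in>{1..N}. P n) \<inter> B"
    by blast
  have "openin X (\<Union>n\<in>{1..N}. P n)"
    using P(1) open_mem by blast
  then have "X interior_of (X closure_of (\<Union>n\<in>{1..N}. P n \<inter> B)) = R \<inter> B"
    unfolding eq using interior_closure_Int_open open_mem[OF assms(2)] regular[OF assms(2)] P(3)
    by metis
  moreover have "disjoint_family_on (\<lambda>n. P n \<inter> B) {1..N}"
    using P(2) by (auto simp: disjoint_family_on_def)
  ultimately show ?thesis
    using P(1) assms(2,3) Int_mem by (auto simp: partition_iff)
qed

lemma trivial_partition: "algebra_partition X \<BB> (topspace X) 1 (\<lambda>_. topspace X)"
  using topspace_mem by (simp add: partition_iff disjoint_family_on_def)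

section \<open>Contents\<close>

lemma content_nonneg: "is_content X \<BB> \<mu> \<Longrightarrow> B \<in> \<BB> \<Longrightarrow> 0 \<le> \<mu> B"
  by (auto simp: is_content_def)

lemma content_sum:
  assumes "is_content X \<BB> \<mu>" "R \<in> \<BB>" "algebra_partition X \<BB> R N P"
  shows "\<mu> R = (\<Sum>n=1..N. \<mu> (P n))"
proof -
  have "\<forall>R N P. R \<in> \<BB> \<and> algebra_partition X \<BB> R N P \<longrightarrow> \<mu> R = (\<Sum>n=1..N. \<mu> (P n))"
    using assms(1) unfolding is_content_def by (rule conjunct2)
  from this[rule_format, OF conjI[OF assms(2,3)]] show ?thesis .
qed

lemma content_partition:
  assumes "is_content X \<BB> \<mu>" "algebra_partition X \<BB> R N P" "B \<in> \<BB>" "B \<subseteq> R"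
  shows "\<mu> B = (\<Sum>n=1..N. \<mu> (P n \<inter> B))"
  by (rule content_sum[OF assms(1,3) partition_Int[OF assms(2-4)]])

lemma content_empty:
  assumes "is_content X \<BB> \<mu>"
  shows "\<mu> {} = 0"
proof -
  \<comment> \<open>With no cells the join is \<open>{}\<close> and the sum in the additivity of
    \<open>\<mu>\<close> is empty.\<close>
  have "algebra_partition X \<BB> {} 0 (\<lambda>_. {})"
    by (simp add: partition_iff disjoint_family_on_def)
  from content_sum[OF assms empty_mem this] show ?thesis
    by simp
qed

abbreviation space_partition :: "nat \<Rightarrow> (nat \<Rightarrow> 'a set) \<Rightarrow> bool" where
  "space_partition \<equiv> algebra_partition X \<BB> (topspace X)"

lemma mem_subset: "B \<in> \<BB> \<Longrightarrow> B \<subseteq> topspace X"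
  using open_mem openin_subset by blast

section \<open>Common refinements and comparison of steps\<close>

text \<open>The cells are all intersections \<open>P n \<inter> Q m\<close>, with index maps
  \<open>\<alpha>\<close> and \<open>\<beta>\<close> back to the two partitions. Step integrals
  survive the refinement because each \<open>P n \<inter> B\<close> is partitioned by the
  \<open>Q m\<close>, and each \<open>Q m \<inter> B\<close> by the \<open>P n\<close>.\<close>

lemma common_refinement:
  assumes P: "space_partition N P" and Q: "space_partition M Q"
  obtains L W \<alpha> \<beta> where "space_partition L W"
    "\<And>l. l \<in> {1..L} \<Longrightarrow> \<alpha> l \<in> {1..N} \<and> \<beta> l \<in> {1..M} \<and> W l = P (\<alpha> l) \<inter> Q (\<beta> l)"
    "\<And>r \<mu> B. is_content X \<BB> \<mu> \<Longrightarrow> B \<in> \<BB> \<Longrightarrow>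
      step_integral L W (r \<circ> \<alpha>) \<mu> B = step_integral N P r \<mu> B"
    "\<And>s \<mu> B. is_content X \<BB> \<mu> \<Longrightarrow> B \<in> \<BB> \<Longrightarrow>
      step_integral L W (s \<circ> \<beta>) \<mu> B = step_integral M Q s \<mu> B"
proof -
  let ?K = "{1..N} \<times> {1..M}"
  let ?L = "card ?K"
  \<comment> \<open>Partitions are indexed by an initial segment from \<open>1\<close>, so the pairs
    must be enumerated. Empty intersections keep their index, which makes the sums over
    \<open>l\<close> plain double sums.\<close>
  obtain \<gamma> where \<gamma>: "bij_betw \<gamma> {1..?L} ?K"
    using ex_bij_betw_nat_finite_1[of ?K] by auto
  define W where "W l = P (fst (\<gamma> l)) \<inter> Q (snd (\<gamma> l))" for l
  have mem: "\<gamma> l \<in> ?K" if "l \<in> {1..?L}" for l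
    using \<gamma> that by (rule bij_betw_apply)
  have PB: "P n \<in> \<BB>" if "n \<in> {1..N}" for n
    using P that by (auto simp: partition_iff)
  have QB: "Q n \<in> \<BB>" if "n \<in> {1..M}" for n
    using Q that by (auto simp: partition_iff)
  have WB: "W l \<in> \<BB>" if "l \<in> {1..?L}" for l
    using mem[OF that] unfolding W_def by (auto intro!: Int_mem PB QB)
  have "disjoint_family_on W {1..?L}"
    unfolding disjoint_family_on_def
  proof (intro ballI impI)
    fix k l assume kl: "k \<in> {1..?L}" "l \<in> {1..?L}" "k \<noteq> l"
    have "\<gamma> k \<noteq> \<gamma> l"
      using \<gamma> kl by (auto simp: bij_betw_def dest: inj_onD)
    then consider "fst (\<gamma> k) \<noteq> fst (\<gamma> l)" | "snd (\<gamma> k) \<noteq> snd (\<gamma> l)"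
      by (auto simp: prod_eq_iff)
    then show "W k \<inter> W l = {}"
    proof cases
      case 1
      moreover have "disjoint_family_on P {1..N}"
        using P by (simp add: algebra_partition_def)
      ultimately have "P (fst (\<gamma> k)) \<inter> P (fst (\<gamma> l)) = {}"
        using mem[OF kl(1)] mem[OF kl(2)] by (auto simp: disjoint_family_on_def mem_Times_iff)
      then show ?thesis
        by (auto simp: W_def)
    next
      case 2
      moreover have "disjoint_family_on Q {1..M}"
        using Q by (simp add: algebra_partition_def)
      ultimately have "Q (snd (\<gamma> k)) \<inter> Q (snd (\<gamma> l)) = {}"
        using mem[OF kl(1)] mem[OF kl(2)] by (auto simp: disjoint_family_on_def mem_Times_iff)
      then show ?thesis
        by (auto simp: W_def)
    qed
  qed
  moreover have "X interior_of (X closure_of (\<Union>l\<in>{1..?L}. W l)) = topspace X"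
  proof -
    have "(\<Union>l\<in>{1..?L}. W l) = (\<Union>k\<in>\<gamma> ` {1..?L}. P (fst k) \<inter> Q (snd k))"
      by (auto simp: W_def)
    also have "\<gamma> ` {1..?L} = ?K"
      using \<gamma> by (simp add: bij_betw_def)
    also have "(\<Union>k\<in>?K. P (fst k) \<inter> Q (snd k)) = (\<Union>n\<in>{1..N}. P n) \<inter> (\<Union>m\<in>{1..M}. Q m)"
      by auto
    finally have eq: "(\<Union>l\<in>{1..?L}. W l) = \<dots>" .
    \<comment> \<open>Both unions are open with regularization \<open>topspace X\<close>; hence so
      is their intersection, although neither need cover the space.\<close>
    have "openin X (\<Union>n\<in>{1..N}. P n)" "openin X (\<Union>m\<in>{1..M}. Q m)"
      using PB QB open_mem by blast+
    then show ?thesis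
      unfolding eq using interior_closure_Int_open P Q by (metis Int_absorb partition_iff)
  qed
  ultimately have part: "space_partition ?L W"
    using WB by (auto simp: partition_iff)
  have sums: "(\<Sum>l=1..?L. c (\<gamma> l) * \<mu> (W l \<inter> B)) =
      (\<Sum>(n, m)\<in>?K. c (n, m) * \<mu> (P n \<inter> Q m \<inter> B))" for c \<mu> B
    using sum.reindex_bij_betw[OF \<gamma>, of "\<lambda>k. c k * \<mu> (P (fst k) \<inter> Q (snd k) \<inter> B)"]
    by (simp add: W_def case_prod_beta)
  have 1: "step_integral ?L W (r \<circ> (fst \<circ> \<gamma>)) \<mu> B = step_integral N P r \<mu> B"
    if "is_content X \<BB> \<mu>" "B \<in> \<BB>" for r \<mu> B
  proof -
    have "step_integral ?L W (r \<circ> (fst \<circ> \<gamma>)) \<mu> B =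
        (\<Sum>n=1..N. \<Sum>m=1..M. r n * \<mu> (P n \<inter> Q m \<inter> B))"
      using sums[of "r \<circ> fst" \<mu> B] by (simp add: step_integral_def sum.cartesian_product)
    also have "\<dots> = (\<Sum>n=1..N. r n * \<mu> (P n \<inter> B))"
    proof (rule sum.cong)
      fix n assume "n \<in> {1..N}"
      then have "\<mu> (P n \<inter> B) = (\<Sum>m=1..M. \<mu> (Q m \<inter> (P n \<inter> B)))"
        using that PB by (intro content_partition[OF _ Q] Int_mem mem_subset)
      then show "(\<Sum>m=1..M. r n * \<mu> (P n \<inter> Q m \<inter> B)) = r n * \<mu> (P n \<inter> B)"
        by (simp add: sum_distrib_left ac_simps)
    qed simp
    finally show ?thesis
      by (simp add: step_integral_def)
  qed
  have 2: "step_integral ?L W (s \<circ> (snd \<circ> \<gamma>)) \<mu> B = step_integral M Q s \<mu> B"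
    if "is_content X \<BB> \<mu>" "B \<in> \<BB>" for s \<mu> B
  proof -
    have "step_integral ?L W (s \<circ> (snd \<circ> \<gamma>)) \<mu> B =
        (\<Sum>n=1..N. \<Sum>m=1..M. s m * \<mu> (P n \<inter> Q m \<inter> B))"
      using sums[of "s \<circ> snd" \<mu> B] by (simp add: step_integral_def sum.cartesian_product)
    also have "\<dots> = (\<Sum>m=1..M. \<Sum>n=1..N. s m * \<mu> (P n \<inter> Q m \<inter> B))"
      by (rule sum.swap)
    also have "\<dots> = (\<Sum>m=1..M. s m * \<mu> (Q m \<inter> B))"
    proof (rule sum.cong)
      fix m assume "m \<in> {1..M}"
      then have "\<mu> (Q m \<inter> B) = (\<Sum>n=1..N. \<mu> (P n \<inter> (Q m \<inter> B)))"
        using that QB by (intro content_partition[OF _ P] Int_mem mem_subset)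
      then show "(\<Sum>n=1..N. s m * \<mu> (P n \<inter> Q m \<inter> B)) = s m * \<mu> (Q m \<inter> B)"
        by (simp add: sum_distrib_left ac_simps)
    qed simp
    finally show ?thesis
      by (simp add: step_integral_def)
  qed
  show thesis
    using mem by (intro that[of ?L W "fst \<circ> \<gamma>" "snd \<circ> \<gamma>", OF part _ 1 2]) (auto simp: W_def mem_Times_iff)
qed

lemma step_integral_const:
  assumes "is_content X \<BB> \<mu>" "space_partition N P" "B \<in> \<BB>"
  shows "step_integral N P (\<lambda>_. c) \<mu> B = c * \<mu> B"
  using content_partition[OF assms mem_subset[OF assms(3)]]
  by (simp add: step_integral_def sum_distrib_left)

text \<open>Values can be compared only where two cells share a point of \<open>B\<close>; the other
  cells of the common refinement contribute zero through \<open>content_empty\<close>. The number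
  \<open>e\<close> may have any sign, so it can hold an approximation error as well as a given
  constant.\<close>

lemma step_integral_mono:
  assumes \<mu>: "is_content X \<BB> \<mu>" and B: "B \<in> \<BB>"
    and P: "space_partition N P" and Q: "space_partition M Q"
    and le: "\<And>n m p. n \<in> {1..N} \<Longrightarrow> m \<in> {1..M} \<Longrightarrow> p \<in> P n \<Longrightarrow> p \<in> Q m \<Longrightarrow> p \<in> B \<Longrightarrow> r n \<le> s m + e"
  shows "step_integral N P r \<mu> B \<le> step_integral M Q s \<mu> B + e * \<mu> B"
proof -
  obtain L W \<alpha> \<beta> where W: "space_partition L W"
    and ab: "\<And>l. l \<in> {1..L} \<Longrightarrow> \<alpha> l \<in> {1..N} \<and> \<beta> l \<in> {1..M} \<and> W l = P (\<alpha> l) \<inter> Q (\<beta> l)"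
    and r: "step_integral L W (r \<circ> \<alpha>) \<mu> B = step_integral N P r \<mu> B"
    and s: "step_integral L W (s \<circ> \<beta>) \<mu> B = step_integral M Q s \<mu> B"
    using common_refinement[OF P Q] \<mu> B by metis
  have "(r \<circ> \<alpha>) l * \<mu> (W l \<inter> B) \<le> (s (\<beta> l) + e) * \<mu> (W l \<inter> B)" if l: "l \<in> {1..L}" for l
  proof (cases "W l \<inter> B = {}")
    case True
    then show ?thesis
      using content_empty[OF \<mu>] by simp
  next
    case False
    then obtain p where "p \<in> W l" "p \<in> B"
      by blast
    then have "r (\<alpha> l) \<le> s (\<beta> l) + e"
      using le ab[OF l] by auto
    moreover have "0 \<le> \<mu> (W l \<inter> B)"
      using W B l by (intro content_nonneg[OF \<mu>] Int_mem) (auto simp: partition_iff)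
    ultimately show ?thesis
      by (simp add: mult_right_mono)
  qed
  \<comment> \<open>The factors \<open>1\<close> give the summand the shape of
    \<open>step_integral_linear\<close>.\<close>
  then have "step_integral L W (r \<circ> \<alpha>) \<mu> B \<le> step_integral L W (\<lambda>l. 1 * (s \<circ> \<beta>) l + 1 * e) \<mu> B"
    unfolding step_integral_def by (intro sum_mono) auto
  also have "\<dots> = step_integral L W (s \<circ> \<beta>) \<mu> B + e * \<mu> B"
    unfolding step_integral_linear step_integral_const[OF \<mu> W B] by (simp only: mult_1)
  finally show ?thesis
    by (simp only: r s)
qed

section \<open>The lower integral\<close>

definition step_approx ::
  "'a set \<Rightarrow> ('a \<Rightarrow> real) \<Rightarrow> real \<Rightarrow> nat \<Rightarrow> (nat \<Rightarrow> 'a set) \<Rightarrow> (nat \<Rightarrow> real) \<Rightarrow> bool" where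
  "step_approx B h e N P r \<longleftrightarrow>
    space_partition N P \<and> (\<forall>n\<in>{1..N}. \<forall>p\<in>P n \<inter> B. \<bar>h p - r n\<bar> \<le> e)"

lemma step_approx_subset: "step_approx A h e N P r \<Longrightarrow> B \<subseteq> A \<Longrightarrow> step_approx B h e N P r"
  by (auto simp: step_approx_def)

text \<open>A lower Darboux integral over finite partitions of the whole space. Only the values of
  \<open>h\<close> on \<open>B\<close> matter, and \<open>h\<close> need not be defined as a
  function on the space, so a restriction to \<open>B\<close> can be inserted directly.\<close>

definition lower_integral :: "('a set \<Rightarrow> real) \<Rightarrow> 'a set \<Rightarrow> ('a \<Rightarrow> real) \<Rightarrow> real" where
  "lower_integral \<mu> B h =
    (SUP (N, P, r)\<in>{(N, P, r). space_partition N P \<and> (\<forall>n\<in>{1..N}. \<forall>p\<in>P n \<inter> B. r n \<le> h p)}.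
      step_integral N P r \<mu> B)"

lemma lower_integral_cong:
  "(\<And>b. b \<in> B \<Longrightarrow> f b = g b) \<Longrightarrow> lower_integral \<mu> B f = lower_integral \<mu> B g"
  unfolding lower_integral_def by (intro SUP_cong) auto

text \<open>Any step below \<open>h\<close> on \<open>B\<close> exceeds \<open>r\<close> by at most
  \<open>e\<close> wherever cells meet inside \<open>B\<close>, which bounds the supremum from
  above; the step \<open>r - e\<close> is itself a competitor and bounds it from below.\<close>

lemma lower_integral_approx:
  assumes \<mu>: "is_content X \<BB> \<mu>" and B: "B \<in> \<BB>" and approx: "step_approx B h e N P r"
  shows "\<bar>lower_integral \<mu> B h - step_integral N P r \<mu> B\<bar> \<le> e * \<mu> B"
proof -
  define A where "A = {(N, P, r). space_partition N P \<and> (\<forall>n\<in>{1..N}. \<forall>p\<in>P n \<inter> B. r n \<le> h p)}"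
  let ?s = "step_integral N P r \<mu> B"
  have P: "space_partition N P" and hr: "\<And>n p. n \<in> {1..N} \<Longrightarrow> p \<in> P n \<Longrightarrow> p \<in> B \<Longrightarrow> \<bar>h p - r n\<bar> \<le> e"
    using approx by (auto simp: step_approx_def)
  have upper: "(case a of (N, P, r) \<Rightarrow> step_integral N P r \<mu> B) \<le> ?s + e * \<mu> B" if a: "a \<in> A" for a
  proof -
    obtain M Q s where [simp]: "a = (M, Q, s)"
      by (cases a)
    have Q: "space_partition M Q" and sh: "\<And>n p. n \<in> {1..M} \<Longrightarrow> p \<in> Q n \<Longrightarrow> p \<in> B \<Longrightarrow> s n \<le> h p"
      using a by (auto simp: A_def)
    have "s n \<le> r m + e" if "n \<in> {1..M}" "m \<in> {1..N}" "p \<in> Q n" "p \<in> P m" "p \<in> B" for n m p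
      using sh[of n p] hr[of m p] that by linarith
    then have "step_integral M Q s \<mu> B \<le> ?s + e * \<mu> B"
      by (rule step_integral_mono[OF \<mu> B Q P])
    then show ?thesis
      by simp
  qed
  have mem: "(N, P, \<lambda>n. 1 * r n + 1 * (- e)) \<in> A"
    using P hr by (force simp: A_def abs_le_iff)
  have "?s - e * \<mu> B = step_integral N P (\<lambda>n. 1 * r n + 1 * (- e)) \<mu> B"
    unfolding step_integral_linear step_integral_const[OF \<mu> P B] by simp
  also have "\<dots> \<le> lower_integral \<mu> B h"
    unfolding lower_integral_def A_def[symmetric]
    using cSUP_upper[OF mem bdd_aboveI2, of "\<lambda>(N, P, r). step_integral N P r \<mu> B"] upper
    by fastforce
  finally have "?s - e * \<mu> B \<le> lower_integral \<mu> B h" .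
  moreover have "lower_integral \<mu> B h \<le> ?s + e * \<mu> B"
    unfolding lower_integral_def A_def[symmetric] using mem by (intro cSUP_least upper) auto
  ultimately show ?thesis
    by (simp add: abs_le_iff)
qed

section \<open>Simple and integrable functions\<close>

lemma simple_stepE:
  assumes "f \<in> simple_functions X \<BB>"
  obtains N P r where "space_partition N P" "\<And>n p. n \<in> {1..N} \<Longrightarrow> p \<in> P n \<Longrightarrow> f p = r n"
proof -
  obtain N P where "space_partition N P" "\<forall>n\<in>{1..N}. f constant_on P n"
    using assms by (auto simp: simple_functions_def)
  moreover from this obtain r where "\<forall>n\<in>{1..N}. \<forall>p\<in>P n. f p = r n"
    unfolding constant_on_def by metis
  ultimately show thesis
    using that by blast
qed

lemma simple_functionsI:
  assumes "f \<in> extensional (topspace X)" "space_partition N P"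
    "\<And>n p. n \<in> {1..N} \<Longrightarrow> p \<in> P n \<Longrightarrow> f p = r n"
  shows "f \<in> simple_functions X \<BB>"
  using assms unfolding simple_functions_def constant_on_def by blast

lemma simple_functions_comp:
  assumes "f \<in> simple_functions X \<BB>"
  shows "(\<lambda>x\<in>topspace X. \<phi> (f x)) \<in> simple_functions X \<BB>"
proof -
  obtain N P r where P: "space_partition N P" "\<And>n p. n \<in> {1..N} \<Longrightarrow> p \<in> P n \<Longrightarrow> f p = r n"
    using simple_stepE[OF assms] by metis
  moreover have "p \<in> topspace X" if "n \<in> {1..N}" "p \<in> P n" for n p
    using mem_subset[OF partition_mem[OF P(1)]] that by blast
  ultimately show ?thesis
    by (intro simple_functionsI[of _ N P "\<phi> \<circ> r"]) auto
qed

lemma simple_functions_linear: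
  assumes "f \<in> simple_functions X \<BB>" "g \<in> simple_functions X \<BB>"
  shows "(\<lambda>x\<in>topspace X. a * f x + b * g x) \<in> simple_functions X \<BB>"
proof -
  obtain N P r where P: "space_partition N P" "\<And>n p. n \<in> {1..N} \<Longrightarrow> p \<in> P n \<Longrightarrow> f p = r n"
    using simple_stepE[OF assms(1)] by metis
  obtain M Q s where Q: "space_partition M Q" "\<And>n p. n \<in> {1..M} \<Longrightarrow> p \<in> Q n \<Longrightarrow> g p = s n"
    using simple_stepE[OF assms(2)] by metis
  obtain L W \<alpha> \<beta> where W: "space_partition L W"
    and ab: "\<And>l. l \<in> {1..L} \<Longrightarrow> \<alpha> l \<in> {1..N} \<and> \<beta> l \<in> {1..M} \<and> W l = P (\<alpha> l) \<inter> Q (\<beta> l)"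
    using common_refinement[OF P(1) Q(1)] by metis
  have "p \<in> topspace X" if "l \<in> {1..L}" "p \<in> W l" for l p
    using mem_subset[OF partition_mem[OF W]] that by blast
  then show ?thesis
    using W ab P(2) Q(2)
    by (intro simple_functionsI[of _ L W "\<lambda>l. a * r (\<alpha> l) + b * s (\<beta> l)"]) force+
qed

lemma integrable_approx:
  assumes "h \<in> integrable_functions X \<BB>" "0 < e"
  obtains f where "f \<in> simple_functions X \<BB>" "\<And>x. x \<in> topspace X \<Longrightarrow> \<bar>h x - f x\<bar> \<le> e"
proof -
  obtain f where f: "\<And>n. f n \<in> simple_functions X \<BB>" "uniform_limit (topspace X) f h sequentially"
    using assms by (auto simp: integrable_functions_def)
  obtain n where "\<forall>x\<in>topspace X. dist (f n x) (h x) < e"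
    using uniform_limitD[OF f(2) assms(2)] eventually_happens' sequentially_bot by blast
  then show thesis
    using that[OF f(1)[of n]] by (simp add: dist_real_def abs_minus_commute less_imp_le)
qed

lemma integrableI:
  assumes ext: "h \<in> extensional (topspace X)" and bd: "bounded (h ` topspace X)"
    and approx: "\<And>e. 0 < e \<Longrightarrow> \<exists>f\<in>simple_functions X \<BB>. \<forall>x\<in>topspace X. \<bar>h x - f x\<bar> \<le> e"
  shows "h \<in> integrable_functions X \<BB>"
proof -
  have "\<exists>f. f \<in> simple_functions X \<BB> \<and> (\<forall>x\<in>topspace X. \<bar>h x - f x\<bar> \<le> 1 / Suc n)" for n
    using approx[of "1 / Suc n"] by auto
  then obtain f where f: "\<And>n. f n \<in> simple_functions X \<BB>"
      "\<And>n x. x \<in> topspace X \<Longrightarrow> \<bar>h x - f n x\<bar> \<le> 1 / Suc n"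
    by metis
  have "uniform_limit (topspace X) f h sequentially"
  proof (rule uniform_limitI)
    fix e :: real assume "0 < e"
    then have "\<forall>\<^sub>F n in sequentially. 1 / Suc n < e"
      using order_tendstoD(2)[OF LIMSEQ_Suc[OF lim_1_over_n]] by simp
    then show "\<forall>\<^sub>F n in sequentially. \<forall>x\<in>topspace X. dist (f n x) (h x) < e"
    proof eventually_elim
      case (elim n)
      then have "\<bar>h x - f n x\<bar> < e" if "x \<in> topspace X" for x
        using f(2)[OF that, of n] by linarith
      then show ?case
        by (simp add: dist_real_def abs_minus_commute)
    qed
  qed
  then show ?thesis
    using ext bd f(1) by (auto simp: integrable_functions_def)
qed

lemma simple_integrable:
  assumes "f \<in> simple_functions X \<BB>" "bounded (f ` topspace X)"
  shows "f \<in> integrable_functions X \<BB>"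
proof (rule integrableI)
  show "f \<in> extensional (topspace X)"
    using assms(1) by (simp add: simple_functions_def)
  show "\<exists>g\<in>simple_functions X \<BB>. \<forall>x\<in>topspace X. \<bar>f x - g x\<bar> \<le> e" if "0 < e" for e
    using assms(1) that by (intro bexI[of _ f]) auto
qed fact

lemma integrable_bound:
  assumes "h \<in> integrable_functions X \<BB>"
  obtains C where "0 \<le> C" "\<And>x. x \<in> topspace X \<Longrightarrow> \<bar>h x\<bar> \<le> C"
proof -
  have "bounded (h ` topspace X)"
    using assms by (simp add: integrable_functions_def)
  then obtain C where "C > 0" "\<forall>y\<in>h ` topspace X. norm y \<le> C"
    using bounded_pos by metis
  then show thesis
    using that[of C] by auto
qed

text \<open>A simple function may be unbounded off its cells and then lies outside the domain of an
  integrator. One that is uniformly close to a bounded function is bounded.\<close>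

lemma integrable_simple_approx:
  assumes "h \<in> integrable_functions X \<BB>" "0 < e"
  obtains f where "f \<in> simple_functions X \<BB>" "f \<in> integrable_functions X \<BB>"
    "\<And>x. x \<in> topspace X \<Longrightarrow> \<bar>h x - f x\<bar> \<le> e"
proof -
  obtain f where f: "f \<in> simple_functions X \<BB>" "\<And>x. x \<in> topspace X \<Longrightarrow> \<bar>h x - f x\<bar> \<le> e"
    using integrable_approx[OF assms] by metis
  obtain C where C: "\<And>x. x \<in> topspace X \<Longrightarrow> \<bar>h x\<bar> \<le> C"
    using integrable_bound[OF assms(1)] by metis
  have "\<bar>f x\<bar> \<le> C + e" if "x \<in> topspace X" for x
    using f(2)[OF that] C[OF that] by linarith
  then have "bounded (f ` topspace X)"
    by (intro boundedI[of _ "C + e"]) auto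
  then show thesis
    using that f simple_integrable by blast
qed

lemma integrable_step_approx:
  assumes "h \<in> integrable_functions X \<BB>" "0 < e"
  obtains N P r where "step_approx (topspace X) h e N P r"
proof -
  obtain f where f: "f \<in> simple_functions X \<BB>" "\<And>x. x \<in> topspace X \<Longrightarrow> \<bar>h x - f x\<bar> \<le> e"
    using integrable_approx[OF assms] by metis
  obtain N P r where "space_partition N P" "\<And>n p. n \<in> {1..N} \<Longrightarrow> p \<in> P n \<Longrightarrow> f p = r n"
    using simple_stepE[OF f(1)] by metis
  then have "step_approx (topspace X) h e N P r"
    using f(2) by (force simp: step_approx_def)
  then show thesis
    by (rule that)
qed

lemma integrable_linear:
  assumes f: "f \<in> integrable_functions X \<BB>" and g: "g \<in> integrable_functions X \<BB>"
  shows "(\<lambda>x\<in>topspace X. a * f x + b * g x) \<in> integrable_functions X \<BB>"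
proof (rule integrableI)
  obtain C where C: "\<And>x. x \<in> topspace X \<Longrightarrow> \<bar>f x\<bar> \<le> C"
    using integrable_bound[OF f] by metis
  obtain D where D: "\<And>x. x \<in> topspace X \<Longrightarrow> \<bar>g x\<bar> \<le> D"
    using integrable_bound[OF g] by metis
  have "\<bar>a * f x + b * g x\<bar> \<le> \<bar>a\<bar> * C + \<bar>b\<bar> * D" if "x \<in> topspace X" for x
    using abs_triangle_ineq[of "a * f x" "b * g x"] mult_left_mono[OF C[OF that] abs_ge_zero[of a]]
      mult_left_mono[OF D[OF that] abs_ge_zero[of b]]
    unfolding abs_mult by linarith
  then show "bounded ((\<lambda>x\<in>topspace X. a * f x + b * g x) ` topspace X)"
    by (intro boundedI[of _ "\<bar>a\<bar> * C + \<bar>b\<bar> * D"]) auto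
next
  fix e :: real assume "0 < e"
  \<comment> \<open>The \<open>+ 1\<close> keeps the divisor positive when \<open>a\<close> and
    \<open>b\<close> vanish.\<close>
  define d where "d = e / (\<bar>a\<bar> + \<bar>b\<bar> + 1)"
  have d: "0 < d" "(\<bar>a\<bar> + \<bar>b\<bar>) * d \<le> e"
    using \<open>0 < e\<close> by (auto simp: d_def field_simps)
  obtain u where u: "u \<in> simple_functions X \<BB>" "\<And>x. x \<in> topspace X \<Longrightarrow> \<bar>f x - u x\<bar> \<le> d"
    using integrable_approx[OF f d(1)] by metis
  obtain v where v: "v \<in> simple_functions X \<BB>" "\<And>x. x \<in> topspace X \<Longrightarrow> \<bar>g x - v x\<bar> \<le> d"
    using integrable_approx[OF g d(1)] by metis
  have "\<bar>a * f x + b * g x - (a * u x + b * v x)\<bar> \<le> e" if "x \<in> topspace X" for x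
    using abs_linear_diff_le[OF u(2) v(2), OF that that, of a b] d(2) by linarith
  then show "\<exists>w\<in>simple_functions X \<BB>. \<forall>x\<in>topspace X. \<bar>(\<lambda>x\<in>topspace X. a * f x + b * g x) x - w x\<bar> \<le> e"
    using simple_functions_linear[OF u(1) v(1), of a b] by (intro bexI) auto
qed simp

lemma const_integrable: "(\<lambda>x\<in>topspace X. c) \<in> integrable_functions X \<BB>"
proof (rule simple_integrable)
  show "(\<lambda>x\<in>topspace X. c) \<in> simple_functions X \<BB>"
    using trivial_partition by (rule simple_functionsI[rotated]) auto
  show "bounded ((\<lambda>x\<in>topspace X. c) ` topspace X)"
    by (intro boundedI[of _ "\<bar>c\<bar>"]) auto
qed

lemma integrable_shift:
  assumes "f \<in> integrable_functions X \<BB>"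
  shows "(\<lambda>x\<in>topspace X. f x + c) \<in> integrable_functions X \<BB>"
proof -
  have "(\<lambda>x\<in>topspace X. f x + c) = (\<lambda>x\<in>topspace X. 1 * f x + c * (\<lambda>x\<in>topspace X. 1) x)"
    by auto
  then show ?thesis
    using integrable_linear[OF assms const_integrable, of 1 c 1] by simp
qed

text \<open>A simple function that is bounded on \<open>B\<close> may be unbounded elsewhere; clamping it
  gives a bounded simple function with the same restriction.\<close>

lemma minorant_integrable_on:
  assumes B: "B \<in> \<BB>" and f: "f \<in> simple_minorants X \<BB> B g"
  shows "f \<in> integrable_functions_on X \<BB> B"
proof -
  obtain F where F: "F \<in> simple_functions X \<BB>" "f = restrict F B" and "bounded (f ` B)"
    using f by (auto simp: simple_minorants_def simple_functions_on_def)
  then obtain C where C: "C > 0" "\<forall>y\<in>f ` B. norm y \<le> C"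
    using bounded_pos by metis
  let ?G = "\<lambda>x\<in>topspace X. max (- C) (min C (F x))"
  have "\<bar>?G x\<bar> \<le> C" if "x \<in> topspace X" for x
    using that C(1) by auto
  then have "bounded (?G ` topspace X)"
    by (intro boundedI[of _ C]) auto
  then have G: "?G \<in> integrable_functions X \<BB>"
    by (intro simple_integrable simple_functions_comp[OF F(1)])
  have "f = restrict ?G B"
  proof
    fix x
    show "f x = restrict ?G B x"
    proof (cases "x \<in> B")
      case True
      then have "\<bar>F x\<bar> \<le> C" "x \<in> topspace X"
        using C(2) F(2) mem_subset[OF B] by auto
      then show ?thesis
        using True F(2) by auto
    qed (simp add: F(2))
  qed
  from image_eqI[where f = "\<lambda>h. restrict h B", OF this G] show ?thesis
    unfolding integrable_functions_on_def .
qed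

lemma integrable_function_space: "bounded_function_space X (integrable_functions X \<BB>)"
  unfolding bounded_function_space_def
  using integrable_linear const_integrable by (auto simp: integrable_functions_def[of X \<BB>])

section \<open>Properties of the lower integral\<close>

text \<open>The partition into one cell approximates with error \<open>0\<close>, so the estimate
  becomes an equation. The cases \<open>c = 1\<close> and \<open>c = 0\<close> are the normalization
  and the vanishing clause of an integrator.\<close>

lemma lower_integral_const:
  assumes "is_content X \<BB> \<mu>" "B \<in> \<BB>" "\<And>b. b \<in> B \<Longrightarrow> h b = c"
  shows "lower_integral \<mu> B h = c * \<mu> B"
proof -
  have "step_approx B h 0 1 (\<lambda>_. topspace X) (\<lambda>_. c)"
    using trivial_partition assms(3) by (auto simp: step_approx_def)
  from lower_integral_approx[OF assms(1,2) this] show ?thesis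
    using step_integral_const[OF assms(1) trivial_partition assms(2)] by simp
qed

lemma lower_integral_mono:
  assumes \<mu>: "is_content X \<BB> \<mu>" and B: "B \<in> \<BB>"
    and f: "f \<in> integrable_functions X \<BB>" and g: "g \<in> integrable_functions X \<BB>"
    and le: "\<And>b. b \<in> B \<Longrightarrow> f b \<le> g b + c"
  shows "lower_integral \<mu> B f \<le> lower_integral \<mu> B g + c * \<mu> B"
proof (rule field_le_epsilon)
  fix d :: real assume d: "0 < d"
  \<comment> \<open>Four errors \<open>e * \<mu> B\<close> add up: two from comparing the values of
    the steps, one from each lower integral. The \<open>+ 1\<close> covers
    \<open>\<mu> B = 0\<close>.\<close>
  define e where "e = d / (4 * (\<mu> B + 1))"
  have pos: "0 \<le> \<mu> B"
    using content_nonneg[OF \<mu> B] .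
  have e: "0 < e" "4 * (e * \<mu> B) \<le> d"
    using d pos by (auto simp: e_def field_simps)
  obtain N P r where P: "step_approx (topspace X) f e N P r"
    by (rule integrable_step_approx[OF f e(1)])
  obtain M Q s where Q: "step_approx (topspace X) g e M Q s"
    by (rule integrable_step_approx[OF g e(1)])
  have P': "step_approx B f e N P r" and Q': "step_approx B g e M Q s"
    using P Q step_approx_subset mem_subset[OF B] by blast+
  have "r n \<le> s m + (c + 2 * e)"
    if "n \<in> {1..N}" "m \<in> {1..M}" "p \<in> P n" "p \<in> Q m" "p \<in> B" for n m p
  proof -
    have "\<bar>f p - r n\<bar> \<le> e" "\<bar>g p - s m\<bar> \<le> e"
      using P' Q' that by (auto simp: step_approx_def)
    then show ?thesis
      using le[OF that(5)] by linarith
  qed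
  then have "step_integral N P r \<mu> B \<le> step_integral M Q s \<mu> B + (c + 2 * e) * \<mu> B"
    using P Q by (intro step_integral_mono[OF \<mu> B]) (auto simp: step_approx_def)
  then have "step_integral N P r \<mu> B \<le> step_integral M Q s \<mu> B + c * \<mu> B + 2 * (e * \<mu> B)"
    by (simp add: algebra_simps)
  then show "lower_integral \<mu> B f \<le> lower_integral \<mu> B g + c * \<mu> B + d"
    using lower_integral_approx[OF \<mu> B P'] lower_integral_approx[OF \<mu> B Q'] e(2) by linarith
qed

text \<open>On a common refinement the same linear combination of the two value families
  approximates the combined function, and step integrals are linear exactly.\<close>

lemma lower_integral_linear:
  assumes \<mu>: "is_content X \<BB> \<mu>" and B: "B \<in> \<BB>"
    and f: "f \<in> integrable_functions X \<BB>" and g: "g \<in> integrable_functions X \<BB>"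
  shows "lower_integral \<mu> B (\<lambda>x\<in>topspace X. a * f x + b * g x) =
    a * lower_integral \<mu> B f + b * lower_integral \<mu> B g"
proof (rule abs_diff_le_all_eq)
  fix e :: real assume e: "0 < e"
  let ?h = "\<lambda>x\<in>topspace X. a * f x + b * g x"
  obtain N P r where "step_approx (topspace X) f e N P r"
    by (rule integrable_step_approx[OF f e])
  then have P: "step_approx B f e N P r"
    by (rule step_approx_subset) (rule mem_subset[OF B])
  obtain M Q s where "step_approx (topspace X) g e M Q s"
    by (rule integrable_step_approx[OF g e])
  then have Q: "step_approx B g e M Q s"
    by (rule step_approx_subset) (rule mem_subset[OF B])
  have parts: "space_partition N P" "space_partition M Q"
    using P Q by (auto simp: step_approx_def)
  obtain L W \<alpha> \<beta> where W: "space_partition L W"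
    and ab: "\<And>l. l \<in> {1..L} \<Longrightarrow> \<alpha> l \<in> {1..N} \<and> \<beta> l \<in> {1..M} \<and> W l = P (\<alpha> l) \<inter> Q (\<beta> l)"
    and r: "step_integral L W (r \<circ> \<alpha>) \<mu> B = step_integral N P r \<mu> B"
    and s: "step_integral L W (s \<circ> \<beta>) \<mu> B = step_integral M Q s \<mu> B"
    using common_refinement[OF parts] \<mu> B by metis
  let ?t = "\<lambda>l. a * (r \<circ> \<alpha>) l + b * (s \<circ> \<beta>) l"
  have "\<bar>?h p - ?t l\<bar> \<le> (\<bar>a\<bar> + \<bar>b\<bar>) * e" if "l \<in> {1..L}" "p \<in> W l \<inter> B" for l p
  proof -
    have "\<bar>f p - (r \<circ> \<alpha>) l\<bar> \<le> e" "\<bar>g p - (s \<circ> \<beta>) l\<bar> \<le> e"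
      using P Q ab[OF that(1)] that(2) by (auto simp: step_approx_def)
    from abs_linear_diff_le[OF this] show ?thesis
      using that(2) mem_subset[OF B] by auto
  qed
  then have "step_approx B ?h ((\<bar>a\<bar> + \<bar>b\<bar>) * e) L W ?t"
    using W by (auto simp: step_approx_def)
  from lower_integral_approx[OF \<mu> B this]
  have "\<bar>lower_integral \<mu> B ?h - (a * step_integral N P r \<mu> B + b * step_integral M Q s \<mu> B)\<bar>
      \<le> ((\<bar>a\<bar> + \<bar>b\<bar>) * e) * \<mu> B"
    by (simp only: step_integral_linear r s)
  moreover have "\<bar>a * lower_integral \<mu> B f + b * lower_integral \<mu> B g -
      (a * step_integral N P r \<mu> B + b * step_integral M Q s \<mu> B)\<bar>
      \<le> (\<bar>a\<bar> + \<bar>b\<bar>) * (e * \<mu> B)"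
    by (intro abs_linear_diff_le lower_integral_approx[OF \<mu> B] P Q)
  \<comment> \<open>The factor \<open>2\<close>: one error for the combined function, one for the
    two separate integrals.\<close>
  ultimately show "\<bar>lower_integral \<mu> B ?h - (a * lower_integral \<mu> B f + b * lower_integral \<mu> B g)\<bar>
      \<le> e * (2 * (\<bar>a\<bar> + \<bar>b\<bar>) * \<mu> B)"
    by (simp add: algebra_simps)
qed

text \<open>Comparison with the zero function in both directions, with \<open>C\<close> as the
  additive constant.\<close>

lemma lower_integral_bound:
  assumes \<mu>: "is_content X \<BB> \<mu>" and B: "B \<in> \<BB>" and h: "h \<in> integrable_functions X \<BB>"
    and C: "\<And>x. x \<in> topspace X \<Longrightarrow> \<bar>h x\<bar> \<le> C"
  shows "\<bar>lower_integral \<mu> B h\<bar> \<le> \<mu> B * C"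
proof -
  let ?z = "\<lambda>x\<in>topspace X. 0"
  have z: "lower_integral \<mu> B ?z = 0"
    using mem_subset[OF B] by (subst lower_integral_const[OF \<mu> B]) auto
  have hC: "h b \<le> ?z b + C" "?z b \<le> h b + C" if "b \<in> B" for b
    using C[of b] that mem_subset[OF B] by (auto simp: abs_le_iff subset_eq)
  show ?thesis
    using lower_integral_mono[OF \<mu> B h const_integrable hC(1)]
      lower_integral_mono[OF \<mu> B const_integrable h hC(2)]
    unfolding z by (simp add: abs_le_iff mult.commute)
qed

text \<open>A single step approximates \<open>h\<close> on all \<open>B k\<close> at once. The
  errors \<open>e * \<mu> (B k)\<close> sum to \<open>e * \<mu> R\<close>, so the number of cells
  does not spoil the estimate.\<close>

lemma lower_integral_additive:
  assumes \<mu>: "is_content X \<BB> \<mu>" and R: "R \<in> \<BB>" and h: "h \<in> integrable_functions X \<BB>"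
    and B: "algebra_partition X \<BB> R K B"
  shows "lower_integral \<mu> R h = (\<Sum>k=1..K. lower_integral \<mu> (B k) h)"
proof (rule abs_diff_le_all_eq)
  fix e :: real assume e: "0 < e"
  obtain N P r where P: "step_approx (topspace X) h e N P r"
    by (rule integrable_step_approx[OF h e])
  let ?s = "step_integral N P r \<mu>"
  have PB: "P n \<in> \<BB>" if "n \<in> {1..N}" for n
    using P that by (auto simp: step_approx_def partition_iff)
  have BB: "B k \<in> \<BB>" if "k \<in> {1..K}" for k
    using B that by (auto simp: partition_iff)
  have close: "\<bar>lower_integral \<mu> A h - ?s A\<bar> \<le> e * \<mu> A" if "A \<in> \<BB>" for A
    using lower_integral_approx[OF \<mu> that step_approx_subset[OF P mem_subset[OF that]]] .
  \<comment> \<open>Regularization is monotone and fixes \<open>B k\<close>.\<close>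
  have sub: "B k \<subseteq> R" if k: "k \<in> {1..K}" for k
  proof -
    have "B k \<subseteq> X interior_of (X closure_of B k)"
      using regular[OF BB[OF k]] by simp
    also have "\<dots> \<subseteq> X interior_of (X closure_of (\<Union>k\<in>{1..K}. B k))"
      using k by (intro interior_of_mono closure_of_mono) auto
    finally show ?thesis
      using B by (simp add: partition_iff)
  qed
  have "\<mu> R = (\<Sum>k=1..K. \<mu> (B k \<inter> R))"
    using content_partition[OF \<mu> B R] by simp
  also have "\<dots> = (\<Sum>k=1..K. \<mu> (B k))"
    using sub by (intro sum.cong refl arg_cong[of _ _ \<mu>]) auto
  finally have \<mu>R: "\<mu> R = (\<Sum>k=1..K. \<mu> (B k))" .
  have cell: "\<mu> (P n \<inter> R) = (\<Sum>k=1..K. \<mu> (P n \<inter> B k))" if n: "n \<in> {1..N}" for n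
  proof -
    have "\<mu> (P n \<inter> R) = (\<Sum>k=1..K. \<mu> (B k \<inter> (P n \<inter> R)))"
      by (intro content_partition[OF \<mu> B] Int_mem PB n R) simp
    also have "\<dots> = (\<Sum>k=1..K. \<mu> (P n \<inter> B k))"
      using sub by (intro sum.cong refl arg_cong[of _ _ \<mu>]) auto
    finally show ?thesis .
  qed
  have "?s R = (\<Sum>n=1..N. \<Sum>k=1..K. r n * \<mu> (P n \<inter> B k))"
    unfolding step_integral_def using cell by (intro sum.cong) (auto simp: sum_distrib_left)
  also have "\<dots> = (\<Sum>k=1..K. ?s (B k))"
    unfolding step_integral_def by (rule sum.swap)
  finally have sR: "?s R = (\<Sum>k=1..K. ?s (B k))" .
  have "\<bar>(\<Sum>k=1..K. lower_integral \<mu> (B k) h) - ?s R\<bar> \<le>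
      (\<Sum>k=1..K. \<bar>lower_integral \<mu> (B k) h - ?s (B k)\<bar>)"
    unfolding sR sum_subtractf[symmetric] by (rule sum_abs)
  also have "\<dots> \<le> e * \<mu> R"
    unfolding \<mu>R sum_distrib_left by (intro sum_mono close BB)
  finally show "\<bar>lower_integral \<mu> R h - (\<Sum>k=1..K. lower_integral \<mu> (B k) h)\<bar> \<le> e * (2 * \<mu> R)"
    using close[OF R] by linarith
qed

text \<open>The approximating step does not depend on the content, so one step serves all three. The
  coefficients may be negative, hence the absolute values in the final bound.\<close>

lemma lower_integral_content_linear:
  assumes "is_content X \<BB> \<mu>" "is_content X \<BB> \<nu>"
    and \<rho>: "is_content X \<BB> (\<lambda>A\<in>\<BB>. a * \<mu> A + b * \<nu> A)"
    and B: "B \<in> \<BB>" and h: "h \<in> integrable_functions X \<BB>"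
  shows "lower_integral (\<lambda>A\<in>\<BB>. a * \<mu> A + b * \<nu> A) B h =
    a * lower_integral \<mu> B h + b * lower_integral \<nu> B h"
proof (rule abs_diff_le_all_eq)
  fix e :: real assume e: "0 < e"
  obtain N P r where "step_approx (topspace X) h e N P r"
    by (rule integrable_step_approx[OF h e])
  then have P: "step_approx B h e N P r"
    by (rule step_approx_subset) (rule mem_subset[OF B])
  let ?\<rho> = "\<lambda>A\<in>\<BB>. a * \<mu> A + b * \<nu> A"
  let ?s = "\<lambda>\<mu>. step_integral N P r \<mu> B" and ?i = "\<lambda>\<mu>. lower_integral \<mu> B h"
  have close: "\<bar>?i \<mu> - ?s \<mu>\<bar> \<le> e * \<mu> B" if "is_content X \<BB> \<mu>" for \<mu>
    by (rule lower_integral_approx[OF that B P])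
  \<comment> \<open>The combined content is a function restricted to \<open>\<BB>\<close>;
    membership is needed to evaluate it on the cells.\<close>
  have "P n \<inter> B \<in> \<BB>" if "n \<in> {1..N}" for n
    using P B that by (auto simp: step_approx_def partition_iff intro!: Int_mem)
  then have "?s ?\<rho> = (\<Sum>n=1..N. a * (r n * \<mu> (P n \<inter> B)) + b * (r n * \<nu> (P n \<inter> B)))"
    unfolding step_integral_def by (intro sum.cong) (auto simp: algebra_simps)
  also have "\<dots> = a * ?s \<mu> + b * ?s \<nu>"
    by (simp add: step_integral_def sum.distrib sum_distrib_left)
  finally have s: "?s ?\<rho> = a * ?s \<mu> + b * ?s \<nu>" .
  have "\<bar>?i ?\<rho> - (a * ?i \<mu> + b * ?i \<nu>)\<bar> =
      \<bar>(?i ?\<rho> - ?s ?\<rho>) - (a * (?i \<mu> - ?s \<mu>) + b * (?i \<nu> - ?s \<nu>))\<bar>"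
    unfolding s by (rule arg_cong[of _ _ abs]) (simp add: algebra_simps)
  also have "\<dots> \<le> \<bar>?i ?\<rho> - ?s ?\<rho>\<bar> + (\<bar>a\<bar> * \<bar>?i \<mu> - ?s \<mu>\<bar> + \<bar>b\<bar> * \<bar>?i \<nu> - ?s \<nu>\<bar>)"
    unfolding abs_mult[symmetric]
    by (rule order_trans[OF abs_triangle_ineq4 add_left_mono[OF abs_triangle_ineq]])
  also have "\<dots> \<le> e * ?\<rho> B + (\<bar>a\<bar> * (e * \<mu> B) + \<bar>b\<bar> * (e * \<nu> B))"
    by (rule add_mono[OF close[OF \<rho>] add_mono[OF mult_left_mono[OF close[OF assms(1)] abs_ge_zero]
          mult_left_mono[OF close[OF assms(2)] abs_ge_zero]]])
  finally show "\<bar>?i ?\<rho> - (a * ?i \<mu> + b * ?i \<nu>)\<bar> \<le> e * (?\<rho> B + (\<bar>a\<bar> * \<mu> B + \<bar>b\<bar> * \<nu> B))"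
    by (simp only: distrib_left mult.left_commute)
qed

section \<open>Existence of an integrator\<close>

lemma is_content_if_contents: "\<mu> \<in> contents X \<BB> \<Longrightarrow> is_content X \<BB> \<mu>"
  by (simp add: contents_def)

lemma integrator_lower_integral:
  "integrator X \<BB> (integrable_functions X \<BB>) (contents X \<BB>)
    (\<lambda>(B, h, \<mu>)\<in>\<BB> \<times> integrable_functions X \<BB> \<times> contents X \<BB>. lower_integral \<mu> B h)"
  (is "integrator X \<BB> ?H ?M ?I")
  unfolding integrator_def
proof (intro conjI ballI allI impI)
  show "bounded_function_space X ?H"
    by (rule integrable_function_space)
  show "?I \<in> extensional (\<BB> \<times> ?H \<times> ?M)"
    by simp
next
  fix B \<mu> f g a b
  assume "B \<in> \<BB>" "\<mu> \<in> ?M" "f \<in> ?H" "g \<in> ?H"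
  then show "?I (B, \<lambda>x\<in>topspace X. a * f x + b * g x, \<mu>) = a * ?I (B, f, \<mu>) + b * ?I (B, g, \<mu>)"
    using integrable_linear lower_integral_linear is_content_if_contents by simp
next
  fix B \<mu>
  assume B: "B \<in> \<BB>" and \<mu>: "\<mu> \<in> ?M"
  \<comment> \<open>The constant of the boundedness clause is \<open>\<mu> B\<close>. Boundedness of
    \<open>h\<close> makes the \<open>SUP\<close> a genuine upper bound.\<close>
  have "\<bar>?I (B, h, \<mu>)\<bar> \<le> \<mu> B * (SUP x\<in>topspace X. \<bar>h x\<bar>)" if h: "h \<in> ?H" for h
  proof -
    obtain C where "\<And>x. x \<in> topspace X \<Longrightarrow> \<bar>h x\<bar> \<le> C"
      using integrable_bound[OF h] by metis
    then have "bdd_above ((\<lambda>x. \<bar>h x\<bar>) ` topspace X)"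
      by (intro bdd_aboveI2)
    then have "\<bar>lower_integral \<mu> B h\<bar> \<le> \<mu> B * (SUP x\<in>topspace X. \<bar>h x\<bar>)"
      by (intro lower_integral_bound[OF is_content_if_contents[OF \<mu>] B h] cSUP_upper)
    then show ?thesis
      using B \<mu> h by simp
  qed
  then show "\<exists>C. \<forall>h\<in>?H. \<bar>?I (B, h, \<mu>)\<bar> \<le> C * (SUP x\<in>topspace X. \<bar>h x\<bar>)"
    by blast
  have "lower_integral \<mu> B (\<lambda>x\<in>topspace X. 1) = 1 * \<mu> B"
    using mem_subset[OF B] by (intro lower_integral_const[OF is_content_if_contents[OF \<mu>] B]) auto
  then show "?I (B, \<lambda>x\<in>topspace X. 1, \<mu>) = \<mu> B"
    using B \<mu> const_integrable by simp
next
  fix B \<mu> f g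
  assume *: "B \<in> \<BB>" "\<mu> \<in> ?M" "f \<in> ?H" "g \<in> ?H" "\<forall>x\<in>topspace X. f x \<le> g x"
  then show "?I (B, f, \<mu>) \<le> ?I (B, g, \<mu>)"
    using lower_integral_mono[OF is_content_if_contents[OF *(2)] *(1,3,4), of 0] mem_subset[OF *(1)]
    by (auto simp: subset_eq)
next
  fix B \<mu> h
  assume *: "B \<in> \<BB>" "\<mu> \<in> ?M" "h \<in> ?H" "\<forall>b\<in>B. h b = 0"
  then show "?I (B, h, \<mu>) = 0"
    using lower_integral_const[OF is_content_if_contents[OF *(2)] *(1), of h 0] by simp
next
  fix h \<mu>
  assume h: "h \<in> ?H" and \<mu>: "\<mu> \<in> ?M" and nonneg: "\<forall>x\<in>topspace X. 0 \<le> h x"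
  have I: "?I (B, h, \<mu>) = lower_integral \<mu> B h" if "B \<in> \<BB>" for B
    using that h \<mu> by simp
  have "0 \<le> lower_integral \<mu> B h" if B: "B \<in> \<BB>" for B
  proof -
    have "lower_integral \<mu> B (\<lambda>x\<in>topspace X. 0) \<le> lower_integral \<mu> B h + 0 * \<mu> B"
      using nonneg mem_subset[OF B]
      by (intro lower_integral_mono[OF is_content_if_contents[OF \<mu>] B const_integrable h]) auto
    moreover have "lower_integral \<mu> B (\<lambda>x\<in>topspace X. 0) = 0 * \<mu> B"
      using mem_subset[OF B] by (intro lower_integral_const[OF is_content_if_contents[OF \<mu>] B]) auto
    ultimately show ?thesis
      by simp
  qed
  moreover have "lower_integral \<mu> R h = (\<Sum>n=1..N. (\<lambda>B\<in>\<BB>. ?I (B, h, \<mu>)) (P n))"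
    if "R \<in> \<BB>" "algebra_partition X \<BB> R N P" for R N P
  proof -
    have "P n \<in> \<BB>" if "n \<in> {1..N}" for n
      using \<open>algebra_partition X \<BB> R N P\<close> that by (auto simp: partition_iff)
    then show ?thesis
      using lower_integral_additive[OF is_content_if_contents[OF \<mu>] that(1) h that(2)] h \<mu> by simp
  qed
  ultimately show "is_content X \<BB> (\<lambda>B\<in>\<BB>. ?I (B, h, \<mu>))"
    unfolding is_content_def using I by auto
next
  fix B h \<mu> \<nu> a b
  assume "B \<in> \<BB>" "h \<in> ?H" "\<mu> \<in> ?M" "\<nu> \<in> ?M" "(\<lambda>A\<in>\<BB>. a * \<mu> A + b * \<nu> A) \<in> ?M"
  then show "?I (B, h, \<lambda>A\<in>\<BB>. a * \<mu> A + b * \<nu> A) = a * ?I (B, h, \<mu>) + b * ?I (B, h, \<nu>)"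
    using lower_integral_content_linear[OF is_content_if_contents is_content_if_contents is_content_if_contents]
    by simp
qed simp

section \<open>What the axioms force on an integrator\<close>

context
  fixes I
  assumes I: "integrator X \<BB> (integrable_functions X \<BB>) (contents X \<BB>) I"
begin

lemmas integrator_functional = I[unfolded integrator_def, THEN conjunct2, THEN conjunct2,
    THEN conjunct2, THEN conjunct1, rule_format]

lemmas integrator_content = I[unfolded integrator_def, THEN conjunct2, THEN conjunct2,
    THEN conjunct2, THEN conjunct2, THEN conjunct1, rule_format]

lemma integrator_linear:
  assumes "B \<in> \<BB>" "\<mu> \<in> contents X \<BB>" "f \<in> integrable_functions X \<BB>" "g \<in> integrable_functions X \<BB>"
  shows "I (B, (\<lambda>x\<in>topspace X. a * f x + b * g x), \<mu>) = a * I (B, f, \<mu>) + b * I (B, g, \<mu>)"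
  by (rule integrator_functional[OF assms(1,2), THEN conjunct1, rule_format, OF assms(3,4)])

lemma integrator_const:
  assumes "B \<in> \<BB>" "\<mu> \<in> contents X \<BB>"
  shows "I (B, (\<lambda>x\<in>topspace X. 1), \<mu>) = \<mu> B"
  using integrator_functional[OF assms] by (elim conjE)

text \<open>Linearity and the value at the constant \<open>1\<close>. Such shifts carry the clauses
  on vanishing and on non-negative functions over to other integrable functions.\<close>

lemma integrator_shift:
  assumes "B \<in> \<BB>" "\<mu> \<in> contents X \<BB>" "f \<in> integrable_functions X \<BB>"
  shows "I (B, (\<lambda>x\<in>topspace X. f x + c), \<mu>) = I (B, f, \<mu>) + c * \<mu> B"
proof -
  have "(\<lambda>x\<in>topspace X. f x + c) = (\<lambda>x\<in>topspace X. 1 * f x + c * (\<lambda>x\<in>topspace X. 1) x)"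
    by auto
  then show ?thesis
    using integrator_linear[OF assms const_integrable, of 1 c 1] integrator_const[OF assms(1,2)]
    by simp
qed

lemma integrator_mono:
  assumes "B \<in> \<BB>" "\<mu> \<in> contents X \<BB>" "f \<in> integrable_functions X \<BB>" "g \<in> integrable_functions X \<BB>"
    and "\<And>x. x \<in> topspace X \<Longrightarrow> f x \<le> g x + c"
  shows "I (B, f, \<mu>) \<le> I (B, g, \<mu>) + c * \<mu> B"
proof -
  have "\<forall>x\<in>topspace X. f x \<le> (\<lambda>x\<in>topspace X. g x + c) x"
    using assms(5) by simp
  then have "I (B, f, \<mu>) \<le> I (B, (\<lambda>x\<in>topspace X. g x + c), \<mu>)"
    using integrator_functional[OF assms(1,2)] assms(3) integrable_shift[OF assms(4)]
    by (elim conjE) blast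
  then show ?thesis
    by (simp only: integrator_shift[OF assms(1,2,4)])
qed

text \<open>The function \<open>f - c\<close> vanishes on \<open>B\<close>, so its integral over
  \<open>B\<close> is zero.\<close>

lemma integrator_const_on:
  assumes "B \<in> \<BB>" "\<mu> \<in> contents X \<BB>" "f \<in> integrable_functions X \<BB>" "\<And>b. b \<in> B \<Longrightarrow> f b = c"
  shows "I (B, f, \<mu>) = c * \<mu> B"
proof -
  have "\<forall>b\<in>B. (\<lambda>x\<in>topspace X. f x + (- c)) b = 0"
    using assms(4) mem_subset[OF assms(1)] by auto
  then have "I (B, (\<lambda>x\<in>topspace X. f x + (- c)), \<mu>) = 0"
    using integrator_functional[OF assms(1,2)] integrable_shift[OF assms(3)] by (elim conjE) blast
  then show ?thesis
    by (simp only: integrator_shift[OF assms(1-3)])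
qed

text \<open>Adding a bound \<open>C\<close> makes \<open>f\<close> non-negative, so its integral
  becomes a content; the surplus \<open>C * \<mu> R\<close> splits in the same way because
  \<open>\<mu>\<close> is additive.\<close>

lemma integrator_additive:
  assumes R: "R \<in> \<BB>" and \<mu>: "\<mu> \<in> contents X \<BB>" and f: "f \<in> integrable_functions X \<BB>"
    and P: "algebra_partition X \<BB> R N P"
  shows "I (R, f, \<mu>) = (\<Sum>n=1..N. I (P n, f, \<mu>))"
proof -
  obtain C where C: "\<And>x. x \<in> topspace X \<Longrightarrow> \<bar>f x\<bar> \<le> C"
    using integrable_bound[OF f] by metis
  let ?g = "\<lambda>x\<in>topspace X. f x + C"
  have PB: "P n \<in> \<BB>" if "n \<in> {1..N}" for n
    using P that by (auto simp: partition_iff)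
  have "0 \<le> f x + C" if "x \<in> topspace X" for x
    using C[OF that] by linarith
  then have "is_content X \<BB> (\<lambda>B\<in>\<BB>. I (B, ?g, \<mu>))"
    by (intro integrator_content integrable_shift f \<mu>) simp
  from content_sum[OF this R P] have "I (R, ?g, \<mu>) = (\<Sum>n=1..N. I (P n, ?g, \<mu>))"
    using R PB by simp
  then have "I (R, f, \<mu>) + C * \<mu> R = (\<Sum>n=1..N. I (P n, f, \<mu>) + C * \<mu> (P n))"
    using integrator_shift[OF _ \<mu> f] R PB by simp
  moreover have "\<mu> R = (\<Sum>n=1..N. \<mu> (P n))"
    by (rule content_sum[OF is_content_if_contents[OF \<mu>] R P])
  ultimately show ?thesis
    by (simp add: sum.distrib sum_distrib_left)
qed

text \<open>The cells cut \<open>B\<close> into pieces on which \<open>f\<close> is constant;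
  additivity over these pieces leaves out the points of \<open>B\<close> between the cells.\<close>

lemma integrator_step:
  assumes B: "B \<in> \<BB>" and \<mu>: "\<mu> \<in> contents X \<BB>" and f: "f \<in> integrable_functions X \<BB>"
    and P: "space_partition N P" and r: "\<And>n p. n \<in> {1..N} \<Longrightarrow> p \<in> P n \<Longrightarrow> f p = r n"
  shows "I (B, f, \<mu>) = step_integral N P r \<mu> B"
proof -
  have "I (B, f, \<mu>) = (\<Sum>n=1..N. I (P n \<inter> B, f, \<mu>))"
    by (intro integrator_additive[OF B \<mu> f] partition_Int[OF P B] mem_subset B)
  also have "\<dots> = (\<Sum>n=1..N. r n * \<mu> (P n \<inter> B))"
    using P B r by (intro sum.cong integrator_const_on[OF _ \<mu> f] Int_mem) (auto simp: partition_iff)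
  finally show ?thesis
    by (simp add: step_integral_def)
qed

text \<open>One step integral lies within \<open>e * \<mu> B\<close> of both sides: of the left by
  monotonicity in the function, of the right by approximation.\<close>

lemma integrator_eq_lower_integral:
  assumes B: "B \<in> \<BB>" and \<mu>: "\<mu> \<in> contents X \<BB>" and h: "h \<in> integrable_functions X \<BB>"
  shows "I (B, h, \<mu>) = lower_integral \<mu> B h"
proof (rule abs_diff_le_all_eq)
  fix e :: real assume e: "0 < e"
  obtain f where f: "f \<in> simple_functions X \<BB>" "f \<in> integrable_functions X \<BB>"
      "\<And>x. x \<in> topspace X \<Longrightarrow> \<bar>h x - f x\<bar> \<le> e"
    using integrable_simple_approx[OF h e] by metis
  obtain N P r where P: "space_partition N P" "\<And>n p. n \<in> {1..N} \<Longrightarrow> p \<in> P n \<Longrightarrow> f p = r n"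
    using simple_stepE[OF f(1)] by metis
  have fI: "I (B, f, \<mu>) = step_integral N P r \<mu> B"
    using integrator_step[OF B \<mu> f(2) P] .
  have "h x \<le> f x + e" "f x \<le> h x + e" if "x \<in> topspace X" for x
    using f(3)[OF that] by linarith+
  then have "I (B, h, \<mu>) \<le> I (B, f, \<mu>) + e * \<mu> B" "I (B, f, \<mu>) \<le> I (B, h, \<mu>) + e * \<mu> B"
    using integrator_mono[OF B \<mu>] h f(2) by blast+
  moreover have "step_approx B h e N P r"
    using P f(3) mem_subset[OF B] by (force simp: step_approx_def)
  then have "\<bar>lower_integral \<mu> B h - step_integral N P r \<mu> B\<bar> \<le> e * \<mu> B"
    by (rule lower_integral_approx[OF is_content_if_contents[OF \<mu>] B])
  ultimately show "\<bar>I (B, h, \<mu>) - lower_integral \<mu> B h\<bar> \<le> e * (2 * \<mu> B)"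
    unfolding fI by linarith
qed

section \<open>Integrals of restrictions and the supremum formula\<close>

text \<open>The lower integral over \<open>B\<close> sees only values on \<open>B\<close>, so all
  integrable extensions of \<open>g\<close> give the same number and the description by
  \<open>THE\<close> is well defined.\<close>

lemma integral_restr_eq:
  assumes B: "B \<in> \<BB>" and \<mu>: "\<mu> \<in> contents X \<BB>" and g: "g \<in> integrable_functions_on X \<BB> B"
  shows "integral_restr X \<BB> I B g \<mu> = lower_integral \<mu> B g"
proof -
  have "I (B, h, \<mu>) = lower_integral \<mu> B g"
    if "h \<in> integrable_functions X \<BB>" "restrict h B = g" for h
    using integrator_eq_lower_integral[OF B \<mu> that(1)] lower_integral_cong[of B h g] that(2)
    by auto
  moreover obtain h where "h \<in> integrable_functions X \<BB>" "restrict h B = g"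
    using g by (auto simp: integrable_functions_on_def)
  ultimately show ?thesis
    unfolding integral_restr_def by (intro the_equality) (metis, metis)
qed

text \<open>Minorants are bounded by monotonicity. Conversely, a uniform approximation of an
  extension of \<open>g\<close>, lowered by its error, is a minorant whose integral is off by at
  most \<open>2 * e * \<mu> B\<close>.\<close>

lemma integral_restr_eq_SUP:
  assumes B: "B \<in> \<BB>" and \<mu>: "\<mu> \<in> contents X \<BB>" and g: "g \<in> integrable_functions_on X \<BB> B"
  shows "integral_restr X \<BB> I B g \<mu> =
    (SUP f\<in>simple_minorants X \<BB> B g. integral_restr X \<BB> I B f \<mu>)"
proof -
  let ?A = "simple_minorants X \<BB> B g" and ?i = "lower_integral \<mu> B"
  note c = is_content_if_contents[OF \<mu>]
  obtain h where h: "h \<in> integrable_functions X \<BB>" "g = restrict h B"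
    using g by (auto simp: integrable_functions_on_def)
  have gh: "?i g = ?i h"
    by (rule lower_integral_cong) (simp add: h(2))
  have upper: "?i f \<le> ?i g" if f: "f \<in> ?A" for f
  proof -
    obtain k where k: "k \<in> integrable_functions X \<BB>" "f = restrict k B"
      using minorant_integrable_on[OF B f] by (auto simp: integrable_functions_on_def)
    have "k b \<le> h b + 0" if "b \<in> B" for b
      using f that k(2) h(2) by (auto simp: simple_minorants_def)
    then have "?i k \<le> ?i h + 0 * \<mu> B"
      by (rule lower_integral_mono[OF c B k(1) h(1)])
    moreover have "?i f = ?i k"
      by (rule lower_integral_cong) (simp add: k(2))
    ultimately show ?thesis
      using gh by simp
  qed
  have lower: "\<exists>f\<in>?A. ?i g \<le> ?i f + 2 * e * \<mu> B" if e: "0 < e" for e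
  proof -
    obtain F where F: "F \<in> simple_functions X \<BB>" "F \<in> integrable_functions X \<BB>"
        "\<And>x. x \<in> topspace X \<Longrightarrow> \<bar>h x - F x\<bar> \<le> e"
      using integrable_simple_approx[OF h(1) e] by metis
    \<comment> \<open>Lowering the function itself, and not only its step values, puts it below
      \<open>h\<close> also at points outside the cells.\<close>
    let ?G = "\<lambda>x\<in>topspace X. F x + (- e)"
    have G: "?G \<in> integrable_functions X \<BB>" "?G \<in> simple_functions X \<BB>"
      by (rule integrable_shift[OF F(2)], rule simple_functions_comp[OF F(1)])
    have hG: "?G x \<le> h x" "h x \<le> ?G x + 2 * e" if "x \<in> topspace X" for x
      using F(3)[OF that] that by (auto simp: abs_le_iff)
    have "bounded (?G ` topspace X)"
      using G(1) by (simp add: integrable_functions_def)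
    then have "bounded (?G ` B)"
      by (rule bounded_subset) (rule image_mono[OF mem_subset[OF B]])
    then have "bounded (restrict ?G B ` B)"
      by (rule back_subst[of bounded]) (intro image_cong refl, simp)
    moreover have "\<forall>b\<in>B. restrict ?G B b \<le> g b"
      using hG(1) h(2) mem_subset[OF B] by auto
    ultimately have "restrict ?G B \<in> ?A"
      using imageI[OF G(2)] unfolding simple_minorants_def simple_functions_on_def
      by (intro CollectI conjI)
    moreover have "?i h \<le> ?i ?G + 2 * e * \<mu> B"
      using hG(2) mem_subset[OF B] by (intro lower_integral_mono[OF c B h(1) G(1)]) blast
    moreover have "?i ?G = ?i (restrict ?G B)"
      by (rule lower_integral_cong) simp
    ultimately show ?thesis
      using gh by (intro bexI[of _ "restrict ?G B"]) auto
  qed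
  have bdd: "bdd_above (?i ` ?A)"
    using upper by (rule bdd_aboveI2)
  have "?i g \<le> (SUP f\<in>?A. ?i f)"
  proof (rule field_le_epsilon)
    fix d :: real assume d: "0 < d"
    let ?e = "d / (2 * (\<mu> B + 1))"
    have pos: "0 \<le> \<mu> B"
      using content_nonneg[OF c B] .
    then obtain f where f: "f \<in> ?A" "?i g \<le> ?i f + 2 * ?e * \<mu> B"
      using lower[of ?e] d by auto
    have "2 * ?e * \<mu> B \<le> d"
      using d pos by (simp add: field_simps)
    then show "?i g \<le> (SUP f\<in>?A. ?i f) + d"
      using f(2) cSUP_upper[OF f(1) bdd] by linarith
  qed
  moreover have "(SUP f\<in>?A. ?i f) \<le> ?i g"
    \<comment> \<open>The instance \<open>1\<close> only shows that \<open>?A\<close> is nonempty,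
      as a supremum of reals requires.\<close>
    using lower[of 1] upper by (intro cSUP_least) auto
  moreover have "(SUP f\<in>?A. integral_restr X \<BB> I B f \<mu>) = (SUP f\<in>?A. ?i f)"
    using integral_restr_eq[OF B \<mu>] minorant_integrable_on[OF B] by (intro SUP_cong) auto
  ultimately show ?thesis
    using integral_restr_eq[OF B \<mu> g] by linarith
qed

end

lemma integrator_unique:
  assumes I: "integrator X \<BB> (integrable_functions X \<BB>) (contents X \<BB>) I"
    and J: "integrator X \<BB> (integrable_functions X \<BB>) (contents X \<BB>) J"
  shows "I = J"
proof (rule extensionalityI)
  show "I \<in> extensional (\<BB> \<times> integrable_functions X \<BB> \<times> contents X \<BB>)"
    "J \<in> extensional (\<BB> \<times> integrable_functions X \<BB> \<times> contents X \<BB>)"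
    using I J by (simp_all add: integrator_def)
  show "I x = J x" if "x \<in> \<BB> \<times> integrable_functions X \<BB> \<times> contents X \<BB>" for x
    using that integrator_eq_lower_integral[OF I] integrator_eq_lower_integral[OF J] by auto
qed

end

theorem theorem4p4:
  fixes X :: "'a topology" and \<BB> :: "'a set set"
  assumes "boolean_subalgebra X \<BB>"
  shows "(\<exists>!I. integrator X \<BB> (integrable_functions X \<BB>) (contents X \<BB>) I) \<and>
    (\<forall>I. integrator X \<BB> (integrable_functions X \<BB>) (contents X \<BB>) I \<longrightarrow>
      (\<forall>f\<in>simple_functions X \<BB>. bounded (f ` topspace X) \<longrightarrow>
        (\<forall>N P r. algebra_partition X \<BB> (topspace X) N P \<and> (\<forall>n\<in>{1..N}. \<forall>p\<in>P n. f p = r n) \<longrightarrow>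
          (\<forall>\<mu>\<in>contents X \<BB>. \<forall>B\<in>\<BB>. I (B, f, \<mu>) = (\<Sum>n=1..N. r n * \<mu> (P n \<inter> B))))) \<and>
      (\<forall>B\<in>\<BB>. \<forall>g\<in>integrable_functions_on X \<BB> B. \<forall>\<mu>\<in>contents X \<BB>.
        integral_restr X \<BB> I B g \<mu> =
          (SUP f\<in>simple_minorants X \<BB> B g. integral_restr X \<BB> I B f \<mu>)))"
proof -
  interpret regular_open_algebra X \<BB>
    by unfold_locales (rule assms)
  show ?thesis
  proof (intro conjI allI impI ballI; (elim conjE)?)
    show "\<exists>!I. integrator X \<BB> (integrable_functions X \<BB>) (contents X \<BB>) I"
      using integrator_lower_integral integrator_unique by blast
  next
    fix I f N P r \<mu> B
    assume I: "integrator X \<BB> (integrable_functions X \<BB>) (contents X \<BB>) I"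
      and "f \<in> simple_functions X \<BB>" "bounded (f ` topspace X)"
      and P: "algebra_partition X \<BB> (topspace X) N P" "\<forall>n\<in>{1..N}. \<forall>p\<in>P n. f p = r n"
      and B: "\<mu> \<in> contents X \<BB>" "B \<in> \<BB>"
    then have "f \<in> integrable_functions X \<BB>"
      by (intro simple_integrable)
    then show "I (B, f, \<mu>) = (\<Sum>n=1..N. r n * \<mu> (P n \<inter> B))"
      using integrator_step[OF I B(2,1) _ P(1)] P(2) by (simp add: step_integral_def)
  next
    fix I B g \<mu>
    assume "integrator X \<BB> (integrable_functions X \<BB>) (contents X \<BB>) I" "B \<in> \<BB>"
      "g \<in> integrable_functions_on X \<BB> B" "\<mu> \<in> contents X \<BB>"
    then show "integral_restr X \<BB> I B g \<mu> =
        (SUP f\<in>simple_minorants X \<BB> B g. integral_restr X \<BB> I B f \<mu>)"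
      by (intro integral_restr_eq_SUP)
  qed
qed

end
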